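(* Let $B$ be a separable Banach space with norm $|\cdot|$, let $(\Omega,\mathcal{F},P)$ be a probability space, and let $(\mathcal{F}^k)_{k\ge1}$ be a decreasing sequence of sub-sigma-fields of $\mathcal{F}$. Let $(X_j)_{j\ge1}$ be a sequence of $B$-valued random variables adapted to $(\mathcal{F}^k)_{k\ge 1}$ (that is, $X_j$ is $\mathcal{F}^j$-measurable for each $j$), and put $S_n=\sum_{j=1}^n X_j$. (i) For every $p>1$ there is a constant $C$ depending only on $p$ such that, if $E|X_j|^p<\infty$ for all $j$, then for all $n\ge1$ $$E\max_{1\le k\le n}|S_k|^p\le C\Big(E\max_{1\le k\le n}|E^kS_k|^p+E|S_n|^p\Big).$$ (ii) If $1\le p\le2$ and $B$ is $p$-smooth, there is a constant $C$ depending only on $p$ and $B$ such that, if $E|X_j|^p<\infty$ for all $j$, then for all $n\ge1$ $$E\max_{1\le k\le n}|S_k|^p\le C\Big(E\max_{1\le k\le n}|E^kS_k|^p+\sum_{i=1}^{n-1}E|P^i(S_i)|^p\Big).$$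
   Context: For an integrable $B$-valued random variable $Y$, $E^jY=E(Y\mid\mathcal{F}^j)$ and $P^i(Y)=E^iY-E^{i+1}Y$. A Banach space $B$ is called $r$-smooth ($1\le r\le2$) if it has an equivalent norm whose modulus of smoothness $\rho(\tau)=\sup\{\tfrac12(|x+\tau y|+|x-\tau y|)-1:\ |x|=|y|=1\}$ satisfies $\rho(\tau)\le K\tau^r$ for some constant $K$ and all $\tau>0$ (for $r=1$ this is no restriction). A known consequence (Assouad, 1975): if $B$ is separable and $r$-smooth there is $D>0$ such that $E|Y_1+\dots+Y_n|^r\le D\sum_{i=1}^nE|Y_i|^r$ for every $n$ and all $B$-valued martingale differences $Y_1,\dots,Y_n$. *)

theory Defs
  imports "HOL-Probability.Probability"
begin

text \<open>
  The library's conditional expectations are real-valued or nonnegative. The following is the usual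
  notion for Bochner integrable functions, where the second argument is a sub-\<open>\<sigma>\<close>-algebra of \<open>M\<close>.
\<close>

definition is_cond_exp ::
  "'a measure \<Rightarrow> 'a measure \<Rightarrow> ('a \<Rightarrow> 'b) \<Rightarrow> ('a \<Rightarrow> 'b::{banach, second_countable_topology}) \<Rightarrow> bool" where
  "is_cond_exp M G Y Z \<longleftrightarrow>
     integrable M Y \<and> integrable M Z \<and> Z \<in> borel_measurable G \<and>
     (\<forall>A\<in>sets G. (LINT x:A|M. Z x) = (LINT x:A|M. Y x))"

text \<open>An arbitrary version is chosen; the value is \<open>0\<close> if there is none.\<close>

definition cond_exp ::
  "'a measure \<Rightarrow> 'a measure \<Rightarrow> ('a \<Rightarrow> 'b) \<Rightarrow> 'a \<Rightarrow> 'b::{banach, second_countable_topology}" where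
  "cond_exp M G Y =
     (if \<exists>Z. is_cond_exp M G Y Z then SOME Z. is_cond_exp M G Y Z else (\<lambda>_. 0))"

definition cond_diff ::
  "'a measure \<Rightarrow> (nat \<Rightarrow> 'a measure) \<Rightarrow> nat \<Rightarrow> ('a \<Rightarrow> 'b) \<Rightarrow> 'a \<Rightarrow> 'b::{banach, second_countable_topology}" where
  "cond_diff M F i Y \<omega> = cond_exp M (F i) Y \<omega> - cond_exp M (F (Suc i)) Y \<omega>"

definition partial_sum :: "(nat \<Rightarrow> 'a \<Rightarrow> 'b::comm_monoid_add) \<Rightarrow> nat \<Rightarrow> 'a \<Rightarrow> 'b" where
  "partial_sum X n \<omega> = (\<Sum>j=1..n. X j \<omega>)"

text \<open>\<open>N\<close> is a norm, equivalent to the given one with constants \<open>a\<close> and \<open>b\<close>; definiteness of \<open>N\<close>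
  is a consequence of \<open>a > 0\<close>.\<close>

definition equivalent_norm :: "real \<Rightarrow> real \<Rightarrow> ('b::real_normed_vector \<Rightarrow> real) \<Rightarrow> bool" where
  "equivalent_norm a b N \<longleftrightarrow>
     0 < a \<and> 0 < b \<and>
     (\<forall>x y. N (x + y) \<le> N x + N y) \<and>
     (\<forall>c x. N (c *\<^sub>R x) = \<bar>c\<bar> * N x) \<and>
     (\<forall>x. a * norm x \<le> N x \<and> N x \<le> b * norm x)"

definition modulus_of_smoothness :: "('b::real_vector \<Rightarrow> real) \<Rightarrow> real \<Rightarrow> real" where
  "modulus_of_smoothness N \<tau> =
     (SUP (x, y)\<in>{(x, y). N x = 1 \<and> N y = 1}. (N (x + \<tau> *\<^sub>R y) + N (x - \<tau> *\<^sub>R y)) / 2 - 1)"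

definition smooth_norm :: "real \<Rightarrow> real \<Rightarrow> ('b::real_vector \<Rightarrow> real) \<Rightarrow> bool" where
  "smooth_norm r K N \<longleftrightarrow> (\<forall>\<tau>>0. modulus_of_smoothness N \<tau> \<le> K * \<tau> powr r)"

definition smooth_space :: "'b::real_normed_vector itself \<Rightarrow> real \<Rightarrow> bool" where
  "smooth_space _ r \<longleftrightarrow>
     1 \<le> r \<and> r \<le> 2 \<and>
     (\<exists>(N :: 'b \<Rightarrow> real) a b K. equivalent_norm a b N \<and> smooth_norm r K N)"

text \<open>
  Constants in the inequalities. An existential quantifier inside a theorem lies below the implicit
  quantification over all types, so the constant it yields could depend on the type of the sample
  space and on that of the Banach space. Named constants whose only parameters are the exponent
  and, where it is allowed, the type of the Banach space express the intended uniformity. The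
  particular values come from a direct argument and are not optimal.

  \<open>max_const p\<close>: from \<open>S k = S n + E k (S k) - E k (S n)\<close> and Doob's \<open>L p\<close> inequality for the
  reversed martingale \<open>E k (S n)\<close>.
\<close>

definition max_const :: "real \<Rightarrow> real" where
  "max_const p = 3 powr (p - 1) * (1 + (p / (p - 1)) powr p)"

text \<open>
  \<open>martingale_type_const\<close> is a constant \<open>D\<close> for Assouad's inequality. If \<open>N\<close> satisfies
  \<open>smooth_norm r K N\<close>, then \<open>(N (x + y) powr r + N (x - y) powr r) / 2 \<le> N x powr r + c * N y powr r\<close>
  with \<open>c = 4 + 2 * K + 2 * K\<^sup>2\<close>, which makes \<open>2 * c\<close> admissible for \<open>N\<close>; passing between \<open>N\<close> and the
  given norm costs the factor \<open>(b / a) powr r\<close>.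
\<close>

definition martingale_type_const :: "'b::real_normed_vector itself \<Rightarrow> real \<Rightarrow> real" where
  "martingale_type_const _ r =
     Inf {(b / a) powr r * (8 + 4 * K + 4 * K\<^sup>2) | (N :: 'b \<Rightarrow> real) a b K.
            equivalent_norm a b N \<and> smooth_norm r K N}"

text \<open>
  From \<open>S k = E k (S k) + D 1 + \<dots> + D (k - 1)\<close>, where \<open>D i\<close> is \<open>cond_diff\<close> of \<open>S i\<close>. At \<open>p = 1\<close> the
  quotient \<open>p / (p - 1)\<close> is \<open>0\<close>; there the inequality needs only a constant \<open>\<ge> 1\<close>.
\<close>

definition smooth_max_const :: "'b::real_normed_vector itself \<Rightarrow> real \<Rightarrow> real" where
  "smooth_max_const T p = 4 powr (p - 1) * (1 + (p / (p - 1)) powr p) * martingale_type_const T p"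

end

theory Submission
  imports Defs
begin

text \<open>
  Both parts rest on Doob's \<open>L p\<close> inequality for the reversed martingale \<open>E k Y\<close>, which is reduced to
  the real case by \<open>N (E k Y) \<le> E k (N Y)\<close>, valid for every continuous seminorm \<open>N\<close>. In (i),
  \<open>S n - S k\<close> is \<open>F k\<close>-measurable, so \<open>S k = S n + E k (S k) - E k (S n)\<close>.

  In (ii), \<open>S k = E k (S k) + D 1 + \<dots> + D (k - 1)\<close>, where \<open>D i\<close> is \<open>F i\<close>-measurable and
  \<open>E (i + 1) (D i) = 0\<close>. With \<open>T = D 1 + \<dots> + D (n - 1)\<close> the sum of the \<open>D i\<close> equals \<open>T - E k T\<close>, and
  \<open>E |T|^p\<close> is bounded by adding the \<open>D i\<close> one at a time, from \<open>i = n - 1\<close> down to \<open>1\<close>: if \<open>R\<close> is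
  \<open>G\<close>-measurable and \<open>E (D | G) = 0\<close>, the two-point inequality of a smooth norm bounds the mean of
  \<open>N (R + D)^p\<close> and \<open>N (R - D)^p\<close>, while \<open>E N (R - D)^p \<ge> E N (R)^p\<close> by Jensen's inequality.
\<close>

subsection \<open>Continuous seminorms and Bochner integrals\<close>

text \<open>Both parts end in the same pointwise bound: |S_k| is at most |E^k S_k| + |Y| + |E^k Y|,
  with Y = S_n in (i) and Y = T in (ii). One maximal inequality therefore serves both.

  Two obstacles shape the proof. Each \<open>cond_exp\<close> is an arbitrary version, so identities
  between conditional expectations hold only almost everywhere. The arguments run on the relation
  \<open>is_cond_exp\<close> instead, for which convenient versions can be written down, such as the
  tail D_k + ... + D_(n-1) as a version of E^k T. And (ii) involves two norms at once: Doob's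
  inequality concerns the given norm, the two-point inequality an equivalent smooth one. Hence
  conditional expectations are compared through a general seminorm \<open>N\<close>.

  The order in which the D_i are added is forced: as the fields decrease, the tail D_(i+1) + ... +
  D_(n-1) is measurable for \<open>F (i + 1)\<close>, which is the field given which D_i has mean
  zero.\<close>

locale bounded_seminorm =
  fixes N :: "'b::{banach, second_countable_topology} \<Rightarrow> real" and b :: real
  assumes triangle: "N (x + y) \<le> N x + N y"
    and scaleR: "N (c *\<^sub>R x) = \<bar>c\<bar> * N x"
    and bound: "N x \<le> b * norm x"
begin

lemma zero [simp]: "N 0 = 0"
  using scaleR[of 0 0] by simp

lemma minus: "N (- x) = N x"
  using scaleR[of "-1" x] by simp

lemma nonneg [simp]: "0 \<le> N x"
  using triangle[of x "- x"] by (simp add: minus)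

lemma diff_le: "N x - N y \<le> N (x - y)"
  using triangle[of "x - y" y] by simp

lemma abs_diff_le: "\<bar>N x - N y\<bar> \<le> b * norm (x - y)"
  using diff_le[of x y] diff_le[of y x] bound[of "x - y"] bound[of "y - x"]
  by (simp add: norm_minus_commute)

lemma sum_le: "N (sum f A) \<le> (\<Sum>i\<in>A. N (f i))"
proof (induction A rule: infinite_finite_induct)
  case (insert i A)
  then show ?case
    using triangle[of "f i" "sum f A"] by simp
qed auto

lemma continuous_on: "continuous_on UNIV N"
proof (rule continuous_on_sequentiallyI)
  fix u :: "nat \<Rightarrow> 'b" and a assume u: "u \<longlonglongrightarrow> a"
  have "(\<lambda>n. b * norm (u n - a)) \<longlonglongrightarrow> 0"
    using u by (intro tendsto_mult_right_zero tendsto_norm_zero LIM_zero)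
  then have "(\<lambda>n. N (u n) - N a) \<longlonglongrightarrow> 0"
    by (rule Lim_null_comparison[rotated]) (auto simp: abs_diff_le)
  then show "(\<lambda>n. N (u n)) \<longlonglongrightarrow> N a"
    by (rule LIM_zero_cancel)
qed

lemma measurable [measurable]: "N \<in> borel_measurable borel"
  by (rule borel_measurable_continuous_onI[OF continuous_on])

lemma integrable: "integrable M f \<Longrightarrow> integrable M (\<lambda>x. N (f x))"
  by (rule Bochner_Integration.integrable_bound[of _ "\<lambda>x. b * norm (f x)"])
     (auto intro!: AE_I2 order_trans[OF bound] abs_ge_self)

text \<open>For simple functions the integral is a finite combination with nonnegative weights, so
  subadditivity and homogeneity suffice. Both sides are continuous under L1 approximation because
  \<open>N\<close> is Lipschitz.\<close>

lemma integral_le: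
  assumes "integrable M f"
  shows "N (\<integral>x. f x \<partial>M) \<le> (\<integral>x. N (f x) \<partial>M)"
proof -
  have "has_bochner_integral M f (\<integral>x. f x \<partial>M)"
    using assms by (rule has_bochner_integral_integrable)
  then obtain s where f [measurable]: "f \<in> borel_measurable M"
    and s: "\<And>i. Bochner_Integration.simple_bochner_integrable M (s i)"
    and lim: "(\<lambda>i. \<integral>\<^sup>+ x. ennreal (norm (f x - s i x)) \<partial>M) \<longlonglongrightarrow> 0"
    and x: "(\<lambda>i. Bochner_Integration.simple_bochner_integral M (s i)) \<longlonglongrightarrow> (\<integral>x. f x \<partial>M)"
    by (rule has_bochner_integral.cases) blast
  have si: "integrable M (s i)" for i
    using s[of i] has_bochner_integral_simple_bochner_integrable Bochner_Integration.integrable.simps by blast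
  have sN: "Bochner_Integration.simple_bochner_integrable M (\<lambda>x. N (s i x))" for i
    using simple_bochner_integrable_compose2[OF _ s[of i] s[of i], of "\<lambda>x y. N x"] by simp
  have le: "N (Bochner_Integration.simple_bochner_integral M (s i)) \<le> (\<integral>x. N (s i x) \<partial>M)" for i
  proof -
    have "N (Bochner_Integration.simple_bochner_integral M (s i)) \<le>
      (\<Sum>y\<in>s i ` space M. N (measure M {x \<in> space M. s i x = y} *\<^sub>R y))"
      unfolding Bochner_Integration.simple_bochner_integral_def by (rule sum_le)
    also have "\<dots> = (\<Sum>y\<in>s i ` space M. measure M {x \<in> space M. s i x = y} *\<^sub>R N y)"
      by (simp add: scaleR)
    also have "\<dots> = Bochner_Integration.simple_bochner_integral M (\<lambda>x. N (s i x))"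
      by (intro simple_bochner_integral_partition[symmetric])
         (use s[of i] sN[of i] in \<open>auto elim: simple_bochner_integrable.cases\<close>)
    also have "\<dots> = (\<integral>x. N (s i x) \<partial>M)"
      by (rule simple_bochner_integrable_eq_integral[OF sN])
    finally show ?thesis .
  qed
  have "(\<lambda>i. \<integral>x. norm (f x - s i x) \<partial>M) \<longlonglongrightarrow> 0"
  proof -
    have "ennreal (\<integral>x. norm (f x - s i x) \<partial>M) = (\<integral>\<^sup>+ x. ennreal (norm (f x - s i x)) \<partial>M)" for i
      by (rule nn_integral_eq_integral[symmetric]) (use assms si in auto)
    with lim have "(\<lambda>i. ennreal (\<integral>x. norm (f x - s i x) \<partial>M)) \<longlonglongrightarrow> ennreal 0" by simp
    then show ?thesis by (subst (asm) tendsto_ennreal_iff) auto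
  qed
  \<comment> \<open>The sign of \<open>b\<close> is not fixed by the locale: on the trivial space it
    may be negative, hence the absolute value.\<close>
  then have "(\<lambda>i. \<bar>b\<bar> * (\<integral>x. norm (f x - s i x) \<partial>M)) \<longlonglongrightarrow> 0"
    by (rule tendsto_mult_right_zero)
  then have "(\<lambda>i. (\<integral>x. N (s i x) \<partial>M) - (\<integral>x. N (f x) \<partial>M)) \<longlonglongrightarrow> 0"
  proof (rule Lim_null_comparison[rotated], intro always_eventually allI)
    fix i
    have "norm ((\<integral>x. N (s i x) \<partial>M) - (\<integral>x. N (f x) \<partial>M)) = norm (\<integral>x. N (s i x) - N (f x) \<partial>M)"
      using assms si by (simp add: integrable)
    also have "\<dots> \<le> (\<integral>x. norm (N (s i x) - N (f x)) \<partial>M)" by simp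
    also have "\<dots> \<le> (\<integral>x. \<bar>b\<bar> * norm (f x - s i x) \<partial>M)"
    proof (rule integral_mono)
      fix x
      have "norm (N (s i x) - N (f x)) \<le> b * norm (s i x - f x)" by (simp add: abs_diff_le)
      also have "\<dots> \<le> \<bar>b\<bar> * norm (f x - s i x)"
        by (simp add: norm_minus_commute mult_right_mono)
      finally show "norm (N (s i x) - N (f x)) \<le> \<bar>b\<bar> * norm (f x - s i x)" .
    qed (use assms si in \<open>intro integrable_norm Bochner_Integration.integrable_diff integrable
      integrable_mult_right; simp\<close>)+
    finally show "norm ((\<integral>x. N (s i x) \<partial>M) - (\<integral>x. N (f x) \<partial>M)) \<le> \<bar>b\<bar> * (\<integral>x. norm (f x - s i x) \<partial>M)"
      by simp
  qed
  then have R: "(\<lambda>i. \<integral>x. N (s i x) \<partial>M) \<longlonglongrightarrow> (\<integral>x. N (f x) \<partial>M)"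
    by (rule LIM_zero_cancel)
  have L: "(\<lambda>i. N (Bochner_Integration.simple_bochner_integral M (s i))) \<longlonglongrightarrow> N (\<integral>x. f x \<partial>M)"
    using continuous_on_tendsto_compose[OF continuous_on x] by simp
  show ?thesis
    by (rule LIMSEQ_le[OF L R]) (use le in auto)
qed

lemma set_integral_le:
  assumes "integrable M f" "A \<in> sets M"
  shows "N (LINT x:A|M. f x) \<le> (LINT x:A|M. N (f x))"
proof -
  have "N (LINT x:A|M. f x) \<le> (\<integral>x. N (indicator A x *\<^sub>R f x) \<partial>M)"
    unfolding set_lebesgue_integral_def
    by (rule integral_le) (use integrable_mult_indicator[OF assms(2,1)] in simp)
  then show ?thesis
    by (simp add: set_lebesgue_integral_def scaleR)
qed

end

lemma bounded_seminorm_norm: "bounded_seminorm norm 1"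
  by standard (auto simp: norm_triangle_ineq)

subsection \<open>Conditional expectations of Banach-valued functions\<close>

lemma (in prob_space) sigma_finite_subalgebra:
  assumes "subalgebra M G"
  shows "sigma_finite_subalgebra M G"
  by (rule finite_measure_subalgebra_is_sigma_finite)
     (simp add: finite_measure_axioms finite_measure_subalgebra_axioms_def finite_measure_subalgebra_def assms)

lemma set_integrable_of_integrable:
  fixes f :: "'a \<Rightarrow> 'b::{banach, second_countable_topology}"
  assumes "integrable M f" "A \<in> sets M"
  shows "set_integrable M A f"
  unfolding set_integrable_def using integrable_mult_indicator[OF assms(2,1)] .

text \<open>
  If \<open>N Z\<close> exceeds the right-hand side \<open>W\<close>, it does so by \<open>3 e\<close> on a set \<open>A z m\<close> where \<open>Z\<close> is within \<open>e\<close> of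
  a point \<open>z\<close> of a countable dense set. Pulling \<open>N\<close> out of the integral of the nearly constant \<open>Z\<close>
  costs only \<open>2 e\<close> times the measure, so all these sets are null.
\<close>

lemma (in prob_space) is_cond_exp_seminorm_le:
  fixes Y :: "'a \<Rightarrow> 'b::{banach, second_countable_topology}"
  assumes G: "subalgebra M G" and YZ: "is_cond_exp M G Y Z" and "bounded_seminorm N b"
  shows "AE x in M. N (Z x) \<le> real_cond_exp M G (\<lambda>x. N (Y x)) x"
proof -
  interpret N: bounded_seminorm N b by fact
  interpret sigma_finite_subalgebra M G by (rule sigma_finite_subalgebra[OF G])
  have Y: "integrable M Y" and Z: "integrable M Z" and ZG [measurable]: "Z \<in> borel_measurable G"
    and eq: "\<And>A. A \<in> sets G \<Longrightarrow> (LINT x:A|M. Z x) = (LINT x:A|M. Y x)"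
    using YZ by (auto simp: is_cond_exp_def)
  define W where "W = real_cond_exp M G (\<lambda>x. N (Y x))"
  have [measurable]: "W \<in> borel_measurable G" by (simp add: W_def)
  have W: "integrable M W" unfolding W_def using real_cond_exp_int(1)[OF N.integrable[OF Y]] .
  have GM: "A \<in> sets G \<Longrightarrow> A \<in> sets M" for A
    using G by (auto simp: subalgebra_def)
  have sp: "space G = space M" using G by (auto simp: subalgebra_def)
  obtain D :: "'b set" where D: "countable D" "\<And>X. open X \<Longrightarrow> X \<noteq> {} \<Longrightarrow> \<exists>d\<in>D. d \<in> X"
    using countable_dense_setE by blast
  \<comment> \<open>The summand \<open>1\<close> keeps the radius meaningful for
    \<open>b = 0\<close>. With \<open>e = inverse (real (Suc m))\<close>, the radius is chosen so
    that \<open>N (Z x - z) \<le> e\<close> on the set.\<close>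
  define A where "A z m = {x \<in> space G. norm (Z x - z) < inverse (real (Suc m)) / (\<bar>b\<bar> + 1)
      \<and> N (Z x) > W x + 3 * inverse (real (Suc m))}" for z m
  have null: "A z m \<in> null_sets M" for z m
  proof -
    define e where "e = inverse (real (Suc m))"
    have e: "e > 0" by (simp add: e_def)
    have AG: "A z m \<in> sets G" unfolding A_def by measurable
    note AM = GM[OF AG]
    have near: "N (Z x - z) \<le> e" if "x \<in> A z m" for x
    proof -
      have "N (Z x - z) \<le> b * norm (Z x - z)" by (rule N.bound)
      also have "\<dots> \<le> (\<bar>b\<bar> + 1) * norm (Z x - z)" by (rule mult_right_mono) auto
      also have "\<dots> \<le> (\<bar>b\<bar> + 1) * (e / (\<bar>b\<bar> + 1))"
        using that by (intro mult_left_mono) (auto simp: A_def e_def)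
      finally show ?thesis by simp
    qed
    let ?P = "measure M (A z m)"
    have const: "(LINT x:A z m|M. c) = ?P *\<^sub>R c" for c :: "'c::{banach, second_countable_topology}"
      unfolding set_lebesgue_integral_def using AM
      by (subst integral_scaleR_left) (auto simp: less_top[symmetric])
    have ci: "set_integrable M (A z m) (\<lambda>x. c)" for c :: "'c::{banach, second_countable_topology}"
      using AM by (intro set_integrable_of_integrable) auto
    have sZ: "set_integrable M (A z m) Z" and sNZ: "set_integrable M (A z m) (\<lambda>x. N (Z x))"
      and sW: "set_integrable M (A z m) W"
      using Z W AM by (auto intro!: set_integrable_of_integrable N.integrable)
    have Zz: "integrable M (\<lambda>x. Z x - z)" using Z by auto
    have "(LINT x:A z m|M. W x) + 3 * e * ?P = (LINT x:A z m|M. W x + 3 * e)"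
      by (subst set_integral_add(2)[OF sW ci]) (simp add: const)
    also have "\<dots> \<le> (LINT x:A z m|M. N (Z x))"
      by (rule set_integral_mono[OF set_integral_add(1)[OF sW ci] sNZ]) (auto simp: A_def e_def)
    also have "\<dots> \<le> (LINT x:A z m|M. N z + e)"
      by (rule set_integral_mono[OF sNZ ci]) (use near N.diff_le[of _ z] in \<open>smt (verit)\<close>)
    also have "\<dots> = N (?P *\<^sub>R z) + e * ?P"
      by (simp add: const N.scaleR algebra_simps)
    also have "?P *\<^sub>R z = (LINT x:A z m|M. Z x) + - (LINT x:A z m|M. Z x - z)"
      by (subst set_integral_diff(2)[OF sZ ci]) (simp add: const)
    also have "N \<dots> \<le> N (LINT x:A z m|M. Z x) + N (LINT x:A z m|M. Z x - z)"
      using N.triangle[of "LINT x:A z m|M. Z x" "- (LINT x:A z m|M. Z x - z)"] by (simp only: N.minus)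
    \<comment> \<open>Here it matters that \<open>A z m\<close> lies in \<open>G\<close>: over such
      a set \<open>Z\<close> integrates like \<open>Y\<close>, and \<open>W\<close> like
      \<open>N\<close> of \<open>Y\<close>.\<close>
    also have "N (LINT x:A z m|M. Z x) \<le> (LINT x:A z m|M. N (Y x))"
      using N.set_integral_le[OF Y AM] by (simp add: eq[OF AG])
    also have "\<dots> = (LINT x:A z m|M. W x)"
      unfolding W_def by (rule real_cond_exp_intA[OF N.integrable[OF Y] AG])
    also have "N (LINT x:A z m|M. Z x - z) \<le> (LINT x:A z m|M. N (Z x - z))"
      by (rule N.set_integral_le[OF Zz AM])
    also have "\<dots> \<le> (LINT x:A z m|M. e)"
      using near AM Zz by (intro set_integral_mono ci) (auto intro!: set_integrable_of_integrable N.integrable)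
    also have "\<dots> = e * ?P" by (simp add: const)
    finally have "e * ?P \<le> 0" by simp
    then have "?P = 0"
      using e by (metis measure_nonneg mult_le_0_iff not_less order_antisym)
    then show ?thesis using AM by (simp add: emeasure_eq_measure null_setsI)
  qed
  have "(\<Union>z\<in>D. \<Union>m. A z m) \<in> null_sets M"
    using D(1) null by (intro null_sets_UN') auto
  moreover have "{x \<in> space M. \<not> N (Z x) \<le> W x} \<subseteq> (\<Union>z\<in>D. \<Union>m. A z m)"
  proof safe
    fix x assume x: "x \<in> space M" "\<not> N (Z x) \<le> W x"
    then obtain m where m: "inverse (real (Suc m)) < (N (Z x) - W x) / 3"
      using reals_Archimedean[of "(N (Z x) - W x) / 3"] by auto
    let ?r = "inverse (real (Suc m)) / (\<bar>b\<bar> + 1)"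
    have r: "?r > 0" by (intro divide_pos_pos) auto
    then obtain z where z: "z \<in> D" "z \<in> ball (Z x) ?r"
      using D(2)[of "ball (Z x) ?r"] centre_in_ball by blast
    have "x \<in> A z m"
      using m z x by (auto simp: A_def sp dist_norm)
    then show "x \<in> (\<Union>z\<in>D. \<Union>m. A z m)" using z by blast
  qed
  ultimately have "AE x in M. N (Z x) \<le> W x" by (rule AE_I')
  then show ?thesis by (simp add: W_def)
qed

section \<open>Linearity and the tower property for given versions\<close>

lemma is_cond_exp_add:
  assumes "subalgebra M G" "is_cond_exp M G Y Z" "is_cond_exp M G Y' Z'"
  shows "is_cond_exp M G (\<lambda>x. Y x + Y' x) (\<lambda>x. Z x + Z' x)"
  using assms unfolding is_cond_exp_def
  by (auto simp: set_integral_add(2)[OF set_integrable_of_integrable set_integrable_of_integrable] subalgebra_def subset_iff)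

lemma is_cond_exp_diff:
  assumes "subalgebra M G" "is_cond_exp M G Y Z" "is_cond_exp M G Y' Z'"
  shows "is_cond_exp M G (\<lambda>x. Y x - Y' x) (\<lambda>x. Z x - Z' x)"
  using assms unfolding is_cond_exp_def
  by (auto simp: set_integral_diff(2)[OF set_integrable_of_integrable set_integrable_of_integrable] subalgebra_def subset_iff)

lemma is_cond_exp_self:
  "integrable M Y \<Longrightarrow> Y \<in> borel_measurable G \<Longrightarrow> is_cond_exp M G Y Y"
  by (simp add: is_cond_exp_def)

lemma is_cond_exp_sum:
  assumes "subalgebra M G" "\<And>i. i \<in> I \<Longrightarrow> is_cond_exp M G (Y i) (Z i)"
  shows "is_cond_exp M G (\<lambda>x. \<Sum>i\<in>I. Y i x) (\<lambda>x. \<Sum>i\<in>I. Z i x)"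
  using assms(2)
  by (induction I rule: infinite_finite_induct) (auto intro: is_cond_exp_self is_cond_exp_add[OF assms(1)])

lemma is_cond_exp_coarser:
  assumes "is_cond_exp M G Y Z" "is_cond_exp M H Y W" "sets H \<subseteq> sets G"
  shows "is_cond_exp M H Z W"
  using assms by (auto simp: is_cond_exp_def)

text \<open>The tower property with no version to supply: the zero function is measurable for every
  field.\<close>

lemma is_cond_exp_zero_coarser:
  assumes "is_cond_exp M G Y (\<lambda>_. 0)" "sets H \<subseteq> sets G"
  shows "is_cond_exp M H Y (\<lambda>_. 0)"
  using assms by (auto simp: is_cond_exp_def)

section \<open>Contraction, uniqueness and existence of conditional expectations\<close>

context prob_space
begin

text \<open>For the norm this is the L1 contraction property, from which uniqueness and existence
  both follow.\<close>

lemma is_cond_exp_seminorm_integral_le: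
  assumes G: "subalgebra M G" and YZ: "is_cond_exp M G Y Z" and N: "bounded_seminorm N b"
  shows "(\<integral>x. N (Z x) \<partial>M) \<le> (\<integral>x. N (Y x) \<partial>M)"
proof -
  interpret N: bounded_seminorm N b by fact
  interpret sigma_finite_subalgebra M G by (rule sigma_finite_subalgebra[OF G])
  have Y: "integrable M Y" and Z: "integrable M Z" using YZ by (auto simp: is_cond_exp_def)
  have "(\<integral>x. N (Z x) \<partial>M) \<le> (\<integral>x. real_cond_exp M G (\<lambda>x. N (Y x)) x \<partial>M)"
    by (intro integral_mono_AE is_cond_exp_seminorm_le[OF G YZ N] N.integrable Z
        real_cond_exp_int(1) Y)
  also have "\<dots> = (\<integral>x. N (Y x) \<partial>M)" by (intro real_cond_exp_int(2) N.integrable Y)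
  finally show ?thesis .
qed

text \<open>The difference of two versions is a version of the conditional expectation of
  \<open>0\<close>, so the L1 contraction makes its norm integrate to \<open>0\<close>.\<close>

lemma is_cond_exp_unique:
  fixes Y :: "'a \<Rightarrow> 'b::{banach, second_countable_topology}"
  assumes G: "subalgebra M G" and "is_cond_exp M G Y Z" "is_cond_exp M G Y Z'"
  shows "AE x in M. Z x = Z' x"
proof -
  have "is_cond_exp M G (\<lambda>x. 0 :: 'b) (\<lambda>x. Z x - Z' x)"
    using is_cond_exp_diff[OF assms] by simp
  from is_cond_exp_seminorm_integral_le[OF G this bounded_seminorm_norm]
  have "(\<integral>x. norm (Z x - Z' x) \<partial>M) \<le> 0" by simp
  moreover have "(\<integral>x. norm (Z x - Z' x) \<partial>M) \<ge> 0" by (rule integral_nonneg_AE) simp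
  ultimately have "(\<integral>x. norm (Z x - Z' x) \<partial>M) = 0" by simp
  then have "AE x in M. norm (Z x - Z' x) = 0"
    using assms by (subst (asm) integral_nonneg_eq_0_iff_AE) (auto simp: is_cond_exp_def)
  then show ?thesis by simp
qed

text \<open>On an indicator times a vector, the real conditional expectation times that vector
  works. In the limit step the contraction carries L1 convergence over to the conditional
  expectations. An almost everywhere convergent series, rather than an abstract L1 limit, gives a
  limit that is visibly \<open>G\<close>-measurable.\<close>

lemma ex_is_cond_exp:
  fixes Y :: "'a \<Rightarrow> 'b::{banach, second_countable_topology}"
  assumes G: "subalgebra M G" and "integrable M Y"
  shows "\<exists>Z. is_cond_exp M G Y Z"
  using assms(2)
proof (induction rule: integrable_induct)
  case (base A c)
  interpret sigma_finite_subalgebra M G by (rule sigma_finite_subalgebra[OF G])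
  let ?r = "real_cond_exp M G (indicator A)"
  have A: "integrable M (indicator A :: 'a \<Rightarrow> real)"
    using base by (simp add: less_top[symmetric])
  have r: "integrable M ?r" by (rule real_cond_exp_int(1)[OF A])
  have "(LINT x:B|M. ?r x *\<^sub>R c) = (LINT x:B|M. (indicator A x :: real) *\<^sub>R c)" if "B \<in> sets G" for B
  proof -
    have B: "B \<in> sets M" using that G by (auto simp: subalgebra_def)
    have *: "(LINT x:B|M. g x *\<^sub>R c) = (LINT x:B|M. g x) *\<^sub>R c" if "integrable M g" for g :: "'a \<Rightarrow> real"
    proof -
      have "(LINT x:B|M. g x *\<^sub>R c) = (\<integral>x. (indicator B x *\<^sub>R g x) *\<^sub>R c \<partial>M)"
        by (simp add: set_lebesgue_integral_def)
      also have "\<dots> = (LINT x:B|M. g x) *\<^sub>R c"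
        unfolding set_lebesgue_integral_def using integrable_mult_indicator[OF B that]
        by (rule integral_scaleR_left)
      finally show ?thesis .
    qed
    show ?thesis using real_cond_exp_intA[OF A that] by (simp add: *[OF A] *[OF r])
  qed
  then have "is_cond_exp M G (\<lambda>x. indicator A x *\<^sub>R c) (\<lambda>x. ?r x *\<^sub>R c)"
    using A r by (auto simp: is_cond_exp_def)
  then show ?case by blast
next
  case (add f g)
  then show ?case using is_cond_exp_add[OF G] by blast
next
  case (lim f s)
  have si: "\<And>i. integrable M (s i)" and fi: "integrable M f"
    and ex: "\<And>i. \<exists>Z. is_cond_exp M G (s i) Z"
    and conv: "\<And>x. x \<in> space M \<Longrightarrow> (\<lambda>i. s i x) \<longlonglongrightarrow> f x"
    and dom: "\<And>i x. x \<in> space M \<Longrightarrow> norm (s i x) \<le> 2 * norm (f x)"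
    by fact+
  have "(\<lambda>i. \<integral>x. norm (s i x - f x) \<partial>M) \<longlonglongrightarrow> (\<integral>x. 0 \<partial>M)"
  proof (rule integral_dominated_convergence[where w = "\<lambda>x. 3 * norm (f x)"])
    show "AE x in M. (\<lambda>i. norm (s i x - f x)) \<longlonglongrightarrow> 0"
      using conv by (intro AE_I2 tendsto_norm_zero LIM_zero)
    show "AE x in M. norm (norm (s i x - f x)) \<le> 3 * norm (f x)" for i
    proof (rule AE_I2)
      fix x assume "x \<in> space M"
      then show "norm (norm (s i x - f x)) \<le> 3 * norm (f x)"
        using dom[of x i] norm_triangle_ineq4[of "s i x" "f x"] by simp
    qed
  qed (use si fi in auto)
  then have L1: "(\<lambda>i. \<integral>x. norm (s i x - f x) \<partial>M) \<longlonglongrightarrow> 0" by simp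
  \<comment> \<open>A subsequence with geometric L1 rate is selected, so that consecutive
    differences have summable L1 norms.\<close>
  have "\<exists>i. (\<integral>x. norm (s i x - f x) \<partial>M) < (1/2)^k" for k
    using order_tendstoD(2)[OF L1, of "(1/2)^k"] by (auto simp: eventually_sequentially)
  then obtain r where r: "\<And>k. (\<integral>x. norm (s (r k) x - f x) \<partial>M) < (1/2)^k" by metis
  define u where "u k = s (r k)" for k
  have u: "integrable M (u k)" for k using si by (simp add: u_def)
  have u2: "(\<integral>x. norm (u k x - f x) \<partial>M) \<le> (1/2)^k" for k
    using r[of k] by (simp add: u_def)
  have "\<forall>k. \<exists>Z. is_cond_exp M G (u k) Z"
    using ex by (simp add: u_def)
  from choice[OF this] obtain Z where Z: "\<And>k. is_cond_exp M G (u k) (Z k)"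
    by blast
  have Zi: "integrable M (Z k)" for k using Z[of k] by (simp add: is_cond_exp_def)
  \<comment> \<open>\<open>L 1\<close> contraction makes the telescoping series of the \<open>Z k\<close> converge absolutely almost everywhere.\<close>
  define d where "d k x = Z (Suc k) x - Z k x" for k x
  have di: "integrable M (d k)" for k
    unfolding d_def by (intro Bochner_Integration.integrable_diff Zi)
  have dG: "d k \<in> borel_measurable G" for k
    using Z[of k] Z[of "Suc k"] unfolding d_def is_cond_exp_def by auto
  have dn: "(\<integral>x. norm (d k x) \<partial>M) \<le> 2 * (1/2)^k" for k
  proof -
    have "(\<integral>x. norm (d k x) \<partial>M) \<le> (\<integral>x. norm (u (Suc k) x - u k x) \<partial>M)"
      unfolding d_def
      by (rule is_cond_exp_seminorm_integral_le[OF G is_cond_exp_diff[OF G Z Z] bounded_seminorm_norm])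
    also have "\<dots> \<le> (\<integral>x. norm (u (Suc k) x - f x) + norm (u k x - f x) \<partial>M)"
    proof (rule integral_mono)
      show "norm (u (Suc k) x - u k x) \<le> norm (u (Suc k) x - f x) + norm (u k x - f x)" for x
        using norm_triangle_ineq4[of "u (Suc k) x - f x" "u k x - f x"] by simp
    qed (use u fi in auto)
    also have "\<dots> \<le> (1/2)^Suc k + (1/2)^k"
      using u fi u2[of "Suc k"] u2[of k] by simp
    also have "\<dots> \<le> 2 * (1/2)^k" by simp
    finally show ?thesis .
  qed
  have dsum: "summable (\<lambda>k. \<integral>x. norm (d k x) \<partial>M)"
    by (rule summable_comparison_test'[of "\<lambda>k. 2 * (1/2)^k" 0])
       (use dn in \<open>auto intro!: summable_mult summable_geometric\<close>)
  have dAE: "AE x in M. summable (\<lambda>k. norm (d k x))"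
  proof -
    have "(\<integral>\<^sup>+x. (\<Sum>k. ennreal (norm (d k x))) \<partial>M) = (\<Sum>k. \<integral>\<^sup>+x. ennreal (norm (d k x)) \<partial>M)"
      using di by (intro nn_integral_suminf) auto
    also have "\<dots> = (\<Sum>k. ennreal (\<integral>x. norm (d k x) \<partial>M))"
      using di by (intro suminf_cong nn_integral_eq_integral) auto
    also have "\<dots> = ennreal (\<Sum>k. \<integral>x. norm (d k x) \<partial>M)"
      using dsum by (intro suminf_ennreal2) auto
    also have "\<dots> \<noteq> \<infinity>" by simp
    finally have "AE x in M. (\<Sum>k. ennreal (norm (d k x))) \<noteq> \<infinity>"
      using di by (intro nn_integral_PInf_AE) auto
    then show ?thesis by eventually_elim (auto intro: summable_suminf_not_top)
  qed
  \<comment> \<open>On the null set of divergence the series has an unspecified constant value,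
    which does not disturb measurability for \<open>G\<close>.\<close>
  define Zl where "Zl x = Z 0 x + (\<Sum>k. d k x)" for x
  have "integrable M (\<lambda>x. \<Sum>k. d k x)" by (rule integrable_suminf[OF di dAE dsum])
  then have Zl: "integrable M Zl" unfolding Zl_def using Zi by auto
  have ZlG: "Zl \<in> borel_measurable G"
    unfolding Zl_def using dG Z[of 0] by (auto simp: is_cond_exp_def)
  have "(LINT x:A|M. Zl x) = (LINT x:A|M. f x)" if A: "A \<in> sets G" for A
  proof -
    have AM: "A \<in> sets M" using A G by (auto simp: subalgebra_def)
    have sd: "integrable M (\<lambda>x. indicator A x *\<^sub>R d k x)" for k
      by (rule integrable_mult_indicator[OF AM di])
    have nle: "norm (indicator A x *\<^sub>R d k x) \<le> norm (d k x)" for x k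
      by (auto simp: indicator_def)
    have "(\<lambda>k. LINT x:A|M. d k x) sums (\<integral>x. (\<Sum>k. indicator A x *\<^sub>R d k x) \<partial>M)"
      unfolding set_lebesgue_integral_def
    proof (rule sums_integral[OF sd])
      show "AE x in M. summable (\<lambda>k. norm (indicator A x *\<^sub>R d k x))"
        using dAE by eventually_elim (rule summable_comparison_test'[of _ 0], assumption, use nle in auto)
      show "summable (\<lambda>k. \<integral>x. norm (indicator A x *\<^sub>R d k x) \<partial>M)"
      proof (rule summable_comparison_test'[OF dsum, of 0])
        fix k
        have "(\<integral>x. norm (indicator A x *\<^sub>R d k x) \<partial>M) \<le> (\<integral>x. norm (d k x) \<partial>M)"
          by (rule integral_mono[OF integrable_norm[OF sd] integrable_norm[OF di] nle])
        then show "norm (\<integral>x. norm (indicator A x *\<^sub>R d k x) \<partial>M) \<le> (\<integral>x. norm (d k x) \<partial>M)"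
          by simp
      qed
    qed
    also have "(\<integral>x. (\<Sum>k. indicator A x *\<^sub>R d k x) \<partial>M) = (LINT x:A|M. (\<Sum>k. d k x))"
      unfolding set_lebesgue_integral_def
      by (intro Bochner_Integration.integral_cong refl) (auto simp: indicator_def)
    also have "\<dots> = (LINT x:A|M. Zl x) - (LINT x:A|M. Z 0 x)"
      using set_integral_diff(2)[OF set_integrable_of_integrable[OF Zl AM] set_integrable_of_integrable[OF Zi AM], of 0]
      by (simp add: Zl_def)
    finally have 1: "(\<lambda>n. \<Sum>k<n. LINT x:A|M. d k x) \<longlonglongrightarrow> (LINT x:A|M. Zl x) - (LINT x:A|M. Z 0 x)"
      by (simp add: sums_def)
    have "(\<Sum>k<n. LINT x:A|M. d k x) = (LINT x:A|M. Z n x) - (LINT x:A|M. Z 0 x)" for n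
      unfolding d_def
      using sum_lessThan_telescope[of "\<lambda>k. LINT x:A|M. Z k x" n]
      by (simp add: set_integral_diff(2)[OF set_integrable_of_integrable[OF Zi AM] set_integrable_of_integrable[OF Zi AM]])
    with 1 have "(\<lambda>n. (LINT x:A|M. Z n x) - (LINT x:A|M. Z 0 x)) \<longlonglongrightarrow> (LINT x:A|M. Zl x) - (LINT x:A|M. Z 0 x)"
      by simp
    \<comment> \<open>Over a set of \<open>G\<close> the integrals of \<open>Z n\<close> and
      \<open>u n\<close> agree. The same integrals also converge to that of \<open>f\<close>, since
      \<open>u n\<close> tends to \<open>f\<close> in L1; comparing the limits identifies
      \<open>Zl\<close>.\<close>
    from tendsto_add[OF this tendsto_const[of "LINT x:A|M. Z 0 x"]]
    have 2: "(\<lambda>n. LINT x:A|M. u n x) \<longlonglongrightarrow> (LINT x:A|M. Zl x)"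
      using Z A by (simp add: is_cond_exp_def)
    have "(\<lambda>n. (LINT x:A|M. u n x) - (LINT x:A|M. f x)) \<longlonglongrightarrow> 0"
    proof (rule Lim_null_comparison)
      show "(\<lambda>k. (1/2::real)^k) \<longlonglongrightarrow> 0" by (rule LIMSEQ_power_zero) simp
      show "\<forall>\<^sub>F n in sequentially. norm ((LINT x:A|M. u n x) - (LINT x:A|M. f x)) \<le> (1/2)^n"
      proof (intro always_eventually allI)
        fix n
        interpret nn: bounded_seminorm norm 1 by (rule bounded_seminorm_norm)
        have uf: "integrable M (\<lambda>x. u n x - f x)" using u fi by auto
        have "norm ((LINT x:A|M. u n x) - (LINT x:A|M. f x)) = norm (LINT x:A|M. u n x - f x)"
          by (simp add: set_integral_diff(2)[OF set_integrable_of_integrable[OF u AM] set_integrable_of_integrable[OF fi AM]])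
        also have "\<dots> \<le> (LINT x:A|M. norm (u n x - f x))"
          by (rule nn.set_integral_le[OF uf AM])
        also have "\<dots> \<le> (\<integral>x. norm (u n x - f x) \<partial>M)"
          unfolding set_lebesgue_integral_def
          by (rule integral_mono[OF integrable_mult_indicator[OF AM integrable_norm[OF uf]] integrable_norm[OF uf]])
             (auto simp: indicator_def)
        also have "\<dots> \<le> (1/2)^n" by (rule u2)
        finally show "norm ((LINT x:A|M. u n x) - (LINT x:A|M. f x)) \<le> (1/2)^n" .
      qed
    qed
    then have "(\<lambda>n. LINT x:A|M. u n x) \<longlonglongrightarrow> (LINT x:A|M. f x)" by (rule LIM_zero_cancel)
    from LIMSEQ_unique[OF 2 this] show ?thesis .
  qed
  then have "is_cond_exp M G f Zl" using Zl ZlG fi by (simp add: is_cond_exp_def)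
  then show ?case by blast
qed

lemma is_cond_exp_cond_exp:
  fixes Y :: "'a \<Rightarrow> 'b::{banach, second_countable_topology}"
  assumes "subalgebra M G" "integrable M Y"
  shows "is_cond_exp M G Y (cond_exp M G Y)"
  using ex_is_cond_exp[OF assms] by (simp add: cond_exp_def someI_ex)

end

subsection \<open>Power inequalities and smooth norms\<close>

text \<open>Convexity on the positive half-line settles the interior; at \<open>u = 0\<close> or
  \<open>v = 0\<close> the claim reduces to \<open>c powr p \<le> c\<close> for \<open>c\<close>
  between \<open>0\<close> and \<open>1\<close>.\<close>

lemma powr_convex_le:
  fixes u v t p :: real
  assumes p: "1 \<le> p" and "0 \<le> u" "0 \<le> v" "0 \<le> t" "t \<le> 1"
  shows "(t * u + (1 - t) * v) powr p \<le> t * u powr p + (1 - t) * v powr p"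
proof -
  have scale: "(c * w) powr p \<le> c * w powr p" if "0 \<le> c" "c \<le> 1" "0 \<le> w" for c w :: real
  proof (cases "c = 0")
    case False
    have "c powr p \<le> c"
      using powr_le_one_le[of c p] that p False by auto
    then show ?thesis using that by (simp add: powr_mult mult_right_mono)
  qed auto
  consider "u = 0" | "v = 0" | "u > 0" "v > 0" using assms by force
  then show ?thesis
  proof cases
    case 1 then show ?thesis using scale[of "1 - t" v] assms by simp
  next
    case 2 then show ?thesis using scale[of t u] assms by simp
  next
    case 3
    then show ?thesis
      using convex_onD[OF powr_convex[OF p], of "1 - t" u v] assms by (simp add: algebra_simps)
  qed
qed

text \<open>The absolute value extends the power convexly to the whole line, the domain on which the
  conditional Jensen inequality is applied.\<close>

lemma convex_on_abs_powr:
  fixes p :: real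
  assumes p: "1 \<le> p"
  shows "convex_on UNIV (\<lambda>x. \<bar>x\<bar> powr p)"
proof (rule convex_onI)
  fix t x y :: real assume t: "0 < t" "t < 1"
  have "\<bar>(1 - t) *\<^sub>R x + t *\<^sub>R y\<bar> powr p \<le> (t * \<bar>y\<bar> + (1 - t) * \<bar>x\<bar>) powr p"
    using t p by (intro powr_mono2) (auto intro!: order_trans[OF abs_triangle_ineq] simp: abs_mult)
  also have "\<dots> \<le> t * \<bar>y\<bar> powr p + (1 - t) * \<bar>x\<bar> powr p"
    by (rule powr_convex_le) (use t p in auto)
  finally show "\<bar>(1 - t) *\<^sub>R x + t *\<^sub>R y\<bar> powr p \<le> (1 - t) * \<bar>x\<bar> powr p + t * \<bar>y\<bar> powr p"
    by simp
qed simp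

text \<open>Convexity at the mean of three numbers, with weights \<open>1/3\<close> and
  \<open>2/3\<close> and then \<open>1/2\<close> and \<open>1/2\<close>. It is the source of the
  factor \<open>3 powr (p - 1)\<close>.\<close>

lemma powr_add3_le:
  fixes a b c p :: real
  assumes p: "1 \<le> p" and "0 \<le> a" "0 \<le> b" "0 \<le> c"
  shows "(a + b + c) powr p \<le> 3 powr (p - 1) * (a powr p + b powr p + c powr p)"
proof -
  have "((a + b + c) / 3) powr p = (1/3 * a + (1 - 1/3) * ((b + c) / 2)) powr p"
    by (rule arg_cong[where f = "\<lambda>x. x powr p"]) (simp add: field_simps)
  also have "\<dots> \<le> 1/3 * a powr p + (1 - 1/3) * ((b + c) / 2) powr p"
    by (rule powr_convex_le) (use assms in auto)
  also have "((b + c) / 2) powr p \<le> 1/2 * b powr p + (1 - 1/2) * c powr p"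
    using powr_convex_le[OF p, of b c "1/2"] assms by (simp add: field_simps)
  finally have le: "((a + b + c) / 3) powr p \<le> (a powr p + b powr p + c powr p) / 3"
    by (simp add: field_simps)
  have "(a + b + c) powr p = 3 powr p * ((a + b + c) / 3) powr p"
    using assms by (simp add: powr_divide)
  moreover have "3 powr p = 3 * 3 powr (p - 1)" by (simp add: powr_mult_base)
  ultimately have "(a + b + c) powr p = 3 * 3 powr (p - 1) * ((a + b + c) / 3) powr p" by simp
  also have "\<dots> \<le> 3 * 3 powr (p - 1) * ((a powr p + b powr p + c powr p) / 3)"
    by (rule mult_left_mono[OF le]) simp
  finally show ?thesis by simp
qed

lemma powr_superadditive:
  fixes u v s :: real
  assumes s: "1 \<le> s" and "0 \<le> u" "0 \<le> v"
  shows "u powr s + v powr s \<le> (u + v) powr s"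
proof -
  have *: "w powr s \<le> w * (u + v) powr (s - 1)" if "0 \<le> w" "w \<le> u + v" for w
  proof -
    have "w powr s = w * w powr (s - 1)" using that by (simp add: powr_mult_base)
    also have "\<dots> \<le> w * (u + v) powr (s - 1)"
      using that s by (intro mult_left_mono powr_mono2) auto
    finally show ?thesis .
  qed
  have "u powr s + v powr s \<le> u * (u + v) powr (s - 1) + v * (u + v) powr (s - 1)"
    using assms by (intro add_mono *) auto
  also have "\<dots> = (u + v) * (u + v) powr (s - 1)" by (simp add: algebra_simps)
  also have "\<dots> = (u + v) powr s" using assms by (simp add: powr_mult_base)
  finally show ?thesis .
qed

text \<open>The power \<open>r / 2 \<le> 1\<close> is concave and subadditive, applied to \<open>(\<alpha>\<^sup>2 + \<beta>\<^sup>2) / 2 = m\<^sup>2 + d\<^sup>2\<close>.\<close>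

lemma powr_two_point:
  fixes \<alpha> \<beta> r :: real
  assumes r: "1 \<le> r" "r \<le> 2" and nn: "0 \<le> \<alpha>" "0 \<le> \<beta>"
  shows "(\<alpha> powr r + \<beta> powr r) / 2 \<le> ((\<alpha> + \<beta>) / 2) powr r + (\<bar>\<alpha> - \<beta>\<bar> / 2) powr r"
proof -
  let ?s = "2 / r" and ?m = "(\<alpha> + \<beta>) / 2" and ?d = "\<bar>\<alpha> - \<beta>\<bar> / 2"
  \<comment> \<open>Concavity and subadditivity of the power \<open>r / 2\<close> are used through
    its inverse \<open>?s = 2 / r\<close>, which is convex and superadditive; the closing
    contradiction removes \<open>?s\<close> by strict monotonicity.\<close>
  have s: "1 \<le> ?s" using r by (simp add: field_simps)
  have pp: "(x powr r) powr ?s = x\<^sup>2" if "0 \<le> x" for x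
    using that r by (simp add: powr_powr powr_numeral)
  have "((\<alpha> powr r + \<beta> powr r) / 2) powr ?s \<le> (\<alpha>\<^sup>2 + \<beta>\<^sup>2) / 2"
    using powr_convex_le[OF s, of "\<alpha> powr r" "\<beta> powr r" "1/2"] nn by (simp add: pp field_simps)
  also have "\<dots> = ?m\<^sup>2 + ?d\<^sup>2"
    by (simp add: power2_eq_square field_simps abs_mult_self_eq)
  also have "\<dots> \<le> (?m powr r + ?d powr r) powr ?s"
    using powr_superadditive[OF s, of "?m powr r" "?d powr r"] nn by (simp add: pp)
  finally have le: "((\<alpha> powr r + \<beta> powr r) / 2) powr ?s \<le> (?m powr r + ?d powr r) powr ?s" .
  show ?thesis
  proof (rule ccontr)
    assume "\<not> ?thesis"
    then have "(?m powr r + ?d powr r) powr ?s < ((\<alpha> powr r + \<beta> powr r) / 2) powr ?s"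
      using r by (intro powr_less_mono2) auto
    with le show False by simp
  qed
qed

text \<open>Here \<open>\<alpha>\<close> and \<open>\<beta>\<close> stand for the norms of x + t y
  and x - t y with unit vectors x and y. For \<open>t \<ge> 1\<close> the triangle inequality alone
  gives \<open>4 * t powr r\<close>. For \<open>t < 1\<close> the mean is at most
  \<open>1 + K * t powr r\<close> and the half-difference at most \<open>t\<close>; squaring the
  mean yields the coefficient \<open>1 + 2 * K + K\<^sup>2\<close>. The stated constant dominates
  both coefficients.\<close>

lemma smooth_two_point_real:
  fixes \<alpha> \<beta> r K t :: real
  assumes r: "1 \<le> r" "r \<le> 2" and nn: "0 \<le> \<alpha>" "0 \<le> \<beta>" and t: "0 < t"
    and le: "\<alpha> \<le> 1 + t" "\<beta> \<le> 1 + t" and d: "\<bar>\<alpha> - \<beta>\<bar> \<le> 2 * t"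
    and m: "1 \<le> (\<alpha> + \<beta>) / 2" "(\<alpha> + \<beta>) / 2 \<le> 1 + K * t powr r"
  shows "(\<alpha> powr r + \<beta> powr r) / 2 \<le> 1 + (4 + 2 * K + 2 * K\<^sup>2) * t powr r"
proof -
  have tr: "0 < t powr r" using t by simp
  have "0 \<le> K * t powr r" using m by linarith
  then have K: "0 \<le> K" using tr by (simp add: zero_le_mult_iff)
  have c: "4 \<le> 4 + 2 * K + 2 * K\<^sup>2" using K by simp
  show ?thesis
  proof (cases "1 \<le> t")
    case True
    have *: "\<gamma> powr r \<le> 4 * t powr r" if "0 \<le> \<gamma>" "\<gamma> \<le> 1 + t" for \<gamma>
    proof -
      have "\<gamma> powr r \<le> (2 * t) powr r" using that True r by (intro powr_mono2) auto
      also have "\<dots> = 2 powr r * t powr r" using t by (simp add: powr_mult)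
      also have "\<dots> \<le> 2 powr 2 * t powr r" using r by (intro mult_right_mono powr_mono) auto
      finally show ?thesis by (simp add: powr_numeral)
    qed
    have "(\<alpha> powr r + \<beta> powr r) / 2 \<le> 4 * t powr r"
      using *[OF nn(1) le(1)] *[OF nn(2) le(2)] by simp
    also have "\<dots> \<le> (4 + 2 * K + 2 * K\<^sup>2) * t powr r"
      using c by (intro mult_right_mono) auto
    finally show ?thesis by simp
  next
    case False
    have t1: "t powr r \<le> 1" using False t r by (simp add: powr_le1)
    have "(\<alpha> powr r + \<beta> powr r) / 2 \<le> ((\<alpha> + \<beta>) / 2) powr r + (\<bar>\<alpha> - \<beta>\<bar> / 2) powr r"
      by (rule powr_two_point[OF r nn])
    also have "(\<bar>\<alpha> - \<beta>\<bar> / 2) powr r \<le> t powr r" using d r by (intro powr_mono2) auto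
    also have "((\<alpha> + \<beta>) / 2) powr r \<le> ((\<alpha> + \<beta>) / 2) powr 2"
      using m r by (intro powr_mono) auto
    also have "\<dots> \<le> (1 + K * t powr r) powr 2"
      using m by (intro powr_mono2) auto
    also have "\<dots> = 1 + 2 * K * t powr r + K\<^sup>2 * (t powr r * t powr r)"
      using K tr by (simp add: powr_numeral power2_eq_square algebra_simps)
    also have "\<dots> \<le> 1 + 2 * K * t powr r + K\<^sup>2 * (t powr r * 1)"
      using t1 by (intro add_left_mono mult_left_mono) auto
    finally have "(\<alpha> powr r + \<beta> powr r) / 2 \<le> 1 + (1 + 2 * K + K\<^sup>2) * t powr r"
      by (simp add: algebra_simps)
    also have "\<dots> \<le> 1 + (4 + 2 * K + 2 * K\<^sup>2) * t powr r"
      by (intro add_left_mono mult_right_mono) auto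
    finally show ?thesis .
  qed
qed

text \<open>The right side equals \<open>(2 * K + 1)\<^sup>2 + 7\<close>, so the bound holds
  whatever the sign of \<open>K\<close>.\<close>

lemma smooth_const_ge: "7 \<le> 8 + 4 * K + 4 * (K::real)\<^sup>2"
  using zero_le_power2[of "2 * K + 1"] by (simp add: power2_eq_square algebra_simps)

text \<open>Both sides are homogeneous of degree \<open>r\<close>, so \<open>x\<close> can be scaled
  to a unit vector and \<open>y\<close> to \<open>t\<close> times a unit vector, where
  \<open>t = N y / N x\<close>. The modulus of smoothness then bounds the mean. Vanishing vectors,
  for which this scaling fails, are treated apart.\<close>

lemma smooth_norm_two_point:
  fixes N :: "'b::real_normed_vector \<Rightarrow> real"
  assumes r: "1 \<le> r" "r \<le> 2" and eq: "equivalent_norm a b N" and sm: "smooth_norm r K N"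
  shows "(N (x + y) powr r + N (x - y) powr r) / 2 \<le> N x powr r + (4 + 2 * K + 2 * K\<^sup>2) * N y powr r"
proof -
  have tri: "N (u + v) \<le> N u + N v" and sc: "N (c *\<^sub>R u) = \<bar>c\<bar> * N u"
    and lo: "a * norm u \<le> N u" and a: "0 < a" for u v c
    using eq by (auto simp: equivalent_norm_def)
  have nn: "0 \<le> N u" for u using lo[of u] a by (smt (verit) mult_nonneg_nonneg norm_ge_zero)
  have N0: "N u = 0 \<Longrightarrow> u = 0" for u
    using lo[of u] a by (simp add: mult_le_0_iff)
  have Nz: "N 0 = 0" using sc[of 0 0] by simp
  have Nm: "N (- u) = N u" for u using sc[of "-1" u] by simp
  have tri': "N (u - v) \<le> N u + N v" for u v using tri[of u "- v"] by (simp add: Nm)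
  show ?thesis
  proof (cases "x = 0 \<or> y = 0")
    case True
    then show ?thesis
    proof
      assume "x = 0"
      have "N y powr r \<le> (4 + 2 * K + 2 * K\<^sup>2) * N y powr r"
        using smooth_const_ge[of K] mult_right_mono[of 1 "4 + 2 * K + 2 * K\<^sup>2" "N y powr r"] by simp
      then show ?thesis using \<open>x = 0\<close> by (simp add: Nz Nm)
    qed (simp add: Nz)
  next
    case False
    define s where "s = N x"
    define t where "t = N y / s"
    have s: "0 < s" and y: "0 < N y" using False nn N0 unfolding s_def by (metis less_eq_real_def)+
    have t: "0 < t" using s y by (simp add: t_def)
    define x' where "x' = (1 / s) *\<^sub>R x"
    define y' where "y' = (1 / N y) *\<^sub>R y"
    have x'1: "N x' = 1" and y'1: "N y' = 1" using s y by (auto simp: x'_def y'_def sc s_def)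
    have Nt: "N (t *\<^sub>R y') = t" using t y'1 by (simp add: sc)
    have plus: "x' + t *\<^sub>R y' = (1 / s) *\<^sub>R (x + y)" and minus: "x' - t *\<^sub>R y' = (1 / s) *\<^sub>R (x - y)"
      using y by (auto simp: x'_def y'_def t_def algebra_simps)
    define \<alpha> where "\<alpha> = N (x' + t *\<^sub>R y')"
    define \<beta> where "\<beta> = N (x' - t *\<^sub>R y')"
    \<comment> \<open>A supremum of reals dominates its members only if they are bounded above; the
      triangle inequality provides the bound \<open>t\<close>.\<close>
    have "(N (x' + t *\<^sub>R y') + N (x' - t *\<^sub>R y')) / 2 - 1 \<le> modulus_of_smoothness N t"
      unfolding modulus_of_smoothness_def
    proof (rule cSUP_upper2[where x = "(x', y')"])
      have "(N (u + t *\<^sub>R v) + N (u - t *\<^sub>R v)) / 2 - 1 \<le> t" if "N u = 1" "N v = 1" for u v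
        using tri[of u "t *\<^sub>R v"] tri'[of u "t *\<^sub>R v"] t that by (simp add: sc field_simps)
      then show "bdd_above ((\<lambda>(u, v). (N (u + t *\<^sub>R v) + N (u - t *\<^sub>R v)) / 2 - 1) ` {(u, v). N u = 1 \<and> N v = 1})"
        by (intro bdd_aboveI2[of _ _ t]) auto
    qed (use x'1 y'1 in auto)
    also have "\<dots> \<le> K * t powr r" using sm t by (simp add: smooth_norm_def)
    finally have "(\<alpha> + \<beta>) / 2 - 1 \<le> K * t powr r" by (simp add: \<alpha>_def \<beta>_def)
    then have m2: "(\<alpha> + \<beta>) / 2 \<le> 1 + K * t powr r" by linarith
    have "(\<alpha> powr r + \<beta> powr r) / 2 \<le> 1 + (4 + 2 * K + 2 * K\<^sup>2) * t powr r"
    proof (rule smooth_two_point_real[OF r _ _ t _ _ _ _ m2])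
      show "\<alpha> \<le> 1 + t" using tri[of x' "t *\<^sub>R y'"] x'1 Nt by (simp add: \<alpha>_def)
      show "\<beta> \<le> 1 + t" using tri'[of x' "t *\<^sub>R y'"] x'1 Nt by (simp add: \<beta>_def)
      \<comment> \<open>The two points differ by \<open>w\<close>, of norm \<open>2 * t\<close>, and
        add up to twice the unit vector \<open>x'\<close>. This bounds the difference of their norms
        above and the mean below.\<close>
      define w where "w = 2 *\<^sub>R (t *\<^sub>R y')"
      have w: "x' - t *\<^sub>R y' + w = x' + t *\<^sub>R y'" "x' + t *\<^sub>R y' - w = x' - t *\<^sub>R y'"
        unfolding w_def scaleR_2 by simp_all
      have "N w = 2 * t" unfolding w_def using Nt sc[of 2 "t *\<^sub>R y'"] by simp
      then show "\<bar>\<alpha> - \<beta>\<bar> \<le> 2 * t"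
        using tri[of "x' - t *\<^sub>R y'" w] tri'[of "x' + t *\<^sub>R y'" w]
        unfolding w \<alpha>_def \<beta>_def by linarith
      have "2 *\<^sub>R x' = (x' + t *\<^sub>R y') + (x' - t *\<^sub>R y')" unfolding scaleR_2 by simp
      then have "2 * N x' \<le> \<alpha> + \<beta>"
        using tri[of "x' + t *\<^sub>R y'" "x' - t *\<^sub>R y'"] sc[of 2 x'] by (simp add: \<alpha>_def \<beta>_def)
      then show "1 \<le> (\<alpha> + \<beta>) / 2" using x'1 by simp
    qed (auto simp: \<alpha>_def \<beta>_def nn)
    note le = this
    have "s * \<alpha> = N (x + y)" "s * \<beta> = N (x - y)" "s * t = N y"
      using s unfolding \<alpha>_def \<beta>_def plus minus by (simp_all add: sc t_def)
    then have "s powr r * \<alpha> powr r = N (x + y) powr r" "s powr r * \<beta> powr r = N (x - y) powr r"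
      "s powr r * t powr r = N y powr r"
      by (metis powr_mult)+
    then have "(N (x + y) powr r + N (x - y) powr r) / 2 = s powr r * ((\<alpha> powr r + \<beta> powr r) / 2)"
      and e: "N y powr r = s powr r * t powr r"
      by (simp_all add: algebra_simps)
    note this(1)
    also have "s powr r * ((\<alpha> powr r + \<beta> powr r) / 2) \<le> s powr r * (1 + (4 + 2 * K + 2 * K\<^sup>2) * t powr r)"
      by (rule mult_left_mono[OF le]) simp
    also have "\<dots> = N x powr r + (4 + 2 * K + 2 * K\<^sup>2) * N y powr r"
      unfolding e by (simp add: s_def algebra_simps)
    finally show ?thesis .
  qed
qed

subsection \<open>Doob's inequality\<close>

text \<open>Conjugate exponents \<open>p\<close> and \<open>p / (p - 1)\<close>, with second factor
  \<open>b powr (p - 1)\<close>. In Doob's inequality this form gives both integrability and the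
  final absorption.\<close>

lemma Youngs_inequality_powr:
  fixes a b p :: real
  assumes p: "1 < p" and "0 \<le> a" "0 \<le> b"
  shows "a * b powr (p - 1) \<le> a powr p / p + (1 - 1 / p) * b powr p"
proof -
  have "a * b powr (p - 1) \<le> a powr p / p + (b powr (p - 1)) powr (p / (p - 1)) / (p / (p - 1))"
    by (rule Youngs_inequality) (use assms in \<open>auto simp: field_simps\<close>)
  also have "(b powr (p - 1)) powr (p / (p - 1)) = b powr p"
    using p by (simp add: powr_powr)
  finally show ?thesis using p by (simp add: field_simps)
qed

text \<open>A discrete form of d(x^p) = p/(p-1) x d(x^(p-1)) for one step of a running maximum from
  \<open>a\<close> to \<open>max c a\<close>: on the way x is at most \<open>c\<close>. After
  cancellation it is Young's inequality for \<open>c * a powr (p - 1)\<close>.\<close>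

lemma max_powr_diff_le:
  fixes a c p :: real
  assumes p: "1 < p" and "0 \<le> a" "0 \<le> c"
  shows "max c a powr p - a powr p \<le> p / (p - 1) * (c * (max c a powr (p - 1) - a powr (p - 1)))"
proof (cases "c \<le> a")
  case False
  have "p / (p - 1) * (c * a powr (p - 1)) \<le> p / (p - 1) * (c powr p / p + (1 - 1 / p) * a powr p)"
    using Youngs_inequality_powr[OF p] assms by (intro mult_left_mono) auto
  also have "\<dots> = c powr p / (p - 1) + a powr p"
    using p by (simp add: field_simps)
  also have "c powr p / (p - 1) = p / (p - 1) * (c * c powr (p - 1)) - c powr p"
    using p assms by (simp add: powr_mult_base field_simps)
  finally show ?thesis using False by (simp add: max_def algebra_simps)
qed (simp add: max_def)

lemma integrable_MAX:
  fixes f :: "'i \<Rightarrow> 'a \<Rightarrow> real"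
  assumes "finite I" "I \<noteq> {}" "\<And>i. i \<in> I \<Longrightarrow> integrable M (f i)"
  shows "integrable M (\<lambda>x. MAX i\<in>I. f i x)"
  using assms
proof (induction I rule: finite_ne_induct)
  case (insert i I)
  then show ?case by (simp add: integrable_max)
qed simp

lemma integrable_mult_powr:
  fixes f g :: "'a \<Rightarrow> real"
  assumes p: "1 < p" and [measurable]: "f \<in> borel_measurable M" "g \<in> borel_measurable M"
    and f: "\<And>x. 0 \<le> f x" "integrable M (\<lambda>x. f x powr p)"
    and g: "\<And>x. 0 \<le> g x" "integrable M (\<lambda>x. g x powr p)"
  shows "integrable M (\<lambda>x. f x * g x powr (p - 1))"
proof (rule Bochner_Integration.integrable_bound)
  show "integrable M (\<lambda>x. f x powr p / p + (1 - 1 / p) * g x powr p)"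
    using f g by auto
  show "AE x in M. norm (f x * g x powr (p - 1)) \<le> norm (f x powr p / p + (1 - 1 / p) * g x powr p)"
    using Youngs_inequality_powr[OF p] f(1) g(1) by (intro AE_I2) (auto intro: order_trans[OF _ abs_ge_self] simp: abs_mult)
qed measurable

context prob_space
begin

text \<open>The bound \<open>N (E Y) \<le> E (N Y)\<close> reduces the claim to Jensen's inequality
  for the real variable \<open>N (Y x)\<close>.\<close>

lemma is_cond_exp_seminorm_powr:
  assumes G: "subalgebra M G" and YZ: "is_cond_exp M G Y Z" and N: "bounded_seminorm N b"
    and p: "1 \<le> p" and int: "integrable M (\<lambda>x. N (Y x) powr p)"
  shows "integrable M (\<lambda>x. N (Z x) powr p)"
    and "(\<integral>x. N (Z x) powr p \<partial>M) \<le> (\<integral>x. N (Y x) powr p \<partial>M)"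
proof -
  interpret N: bounded_seminorm N b by fact
  interpret sigma_finite_subalgebra M G by (rule sigma_finite_subalgebra[OF G])
  have Y: "integrable M Y" and Z: "integrable M Z" using YZ by (auto simp: is_cond_exp_def)
  note [measurable] = borel_measurable_integrable[OF Z]
  let ?R = "real_cond_exp M G (\<lambda>x. N (Y x))"
  let ?Q = "real_cond_exp M G (\<lambda>x. N (Y x) powr p)"
  have Qi: "integrable M ?Q" by (rule real_cond_exp_int(1)[OF int])
  have "AE x in M. \<bar>?R x\<bar> powr p \<le> real_cond_exp M G (\<lambda>x. \<bar>N (Y x)\<bar> powr p) x"
    by (rule real_cond_exp_jensens_inequality(2)[of _ UNIV _ _ "\<lambda>x. \<bar>x\<bar> powr p"])
       (use int p in \<open>auto intro!: N.integrable Y convex_on_abs_powr\<close>)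
  with is_cond_exp_seminorm_le[OF G YZ N] have le: "AE x in M. N (Z x) powr p \<le> ?Q x"
  proof eventually_elim
    case (elim x)
    then have "N (Z x) powr p \<le> \<bar>?R x\<bar> powr p" using p by (intro powr_mono2) auto
    with elim show ?case by simp
  qed
  show *: "integrable M (\<lambda>x. N (Z x) powr p)"
    by (rule Bochner_Integration.integrable_bound[OF Qi]) (use le in \<open>auto elim!: eventually_mono\<close>)
  have "(\<integral>x. N (Z x) powr p \<partial>M) \<le> (\<integral>x. ?Q x \<partial>M)" by (rule integral_mono_AE[OF * Qi le])
  also have "\<dots> = (\<integral>x. N (Y x) powr p \<partial>M)" by (rule real_cond_exp_int(2)[OF int])
  finally show "(\<integral>x. N (Z x) powr p \<partial>M) \<le> (\<integral>x. N (Y x) powr p \<partial>M)" .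
qed

text \<open>No weak-type estimate or stopping time enters. Running maxima are built towards smaller
  indices, that is, towards larger fields, so each stays measurable for the current one. Adding the
  increments of their \<open>p\<close>-th powers gives E m^p \<le> q E(|Y| m^(p-1)) with
  \<open>q = p / (p - 1)\<close>, and Young's inequality separates the factors.\<close>

lemma reversed_Doob_maximal_powr:
  fixes Y :: "'a \<Rightarrow> 'b::{banach, second_countable_topology}"
  assumes p: "1 < p"
    and F: "\<And>k. 1 \<le> k \<Longrightarrow> subalgebra M (F k)"
    and dec: "\<And>k. 1 \<le> k \<Longrightarrow> sets (F (Suc k)) \<subseteq> sets (F k)"
    and Z: "\<And>k. 1 \<le> k \<Longrightarrow> k \<le> n \<Longrightarrow> is_cond_exp M (F k) Y (Z k)"
    and int: "integrable M (\<lambda>x. norm (Y x) powr p)"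
    and n: "1 \<le> n"
  shows "integrable M (\<lambda>x. MAX k\<in>{1..n}. norm (Z k x) powr p)"
    and "(\<integral>x. (MAX k\<in>{1..n}. norm (Z k x) powr p) \<partial>M) \<le> (p / (p - 1)) powr p * (\<integral>x. norm (Y x) powr p \<partial>M)"
proof -
  let ?q = "p / (p - 1)"
  have q: "0 < ?q" using p by simp
  have Y: "integrable M Y" using Z[of 1] n by (simp add: is_cond_exp_def)
  note [measurable] = borel_measurable_integrable[OF Y]
  have Zp: "integrable M (\<lambda>x. norm (Z k x) powr p)" if "1 \<le> k" "k \<le> n" for k
    by (rule is_cond_exp_seminorm_powr(1)[OF F Z bounded_seminorm_norm _ int]) (use that p in auto)
  show I: "integrable M (\<lambda>x. MAX k\<in>{1..n}. norm (Z k x) powr p)"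
    by (rule integrable_MAX) (use n Zp in auto)
  \<comment> \<open>Running maxima from \<open>n\<close> downwards; the \<open>0\<close> gives \<open>m (n + 1) = 0\<close>, where \<open>Max {}\<close> would be unspecified.\<close>
  define m where "m k x = Max (insert 0 ((\<lambda>j. norm (Z j x)) ` {k..n}))" for k x
  have m_last: "m (Suc n) x = 0" for x by (simp add: m_def)
  have m_rec: "m k x = max (norm (Z k x)) (m (Suc k) x)" if "k \<le> n" for k x
  proof -
    have "{k..n} = insert k {Suc k..n}" using that by auto
    then have "m k x = Max (insert (norm (Z k x)) (insert 0 ((\<lambda>j. norm (Z j x)) ` {Suc k..n})))"
      unfolding m_def by (simp only: image_insert insert_commute)
    also have "\<dots> = max (norm (Z k x)) (m (Suc k) x)"
      by (subst Max_insert) (simp_all add: m_def)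
    finally show ?thesis .
  qed
  have m0: "0 \<le> m k x" for k x by (simp add: m_def)
  have "m 1 \<in> borel_measurable (F 1) \<and> integrable M (\<lambda>x. m 1 x powr p) \<and>
      (\<integral>x. m 1 x powr p \<partial>M) \<le> ?q * (\<integral>x. norm (Y x) * m 1 x powr (p - 1) \<partial>M)"
  proof (rule inc_induct[where i = 1 and j = "Suc n"])
    show "m (Suc n) \<in> borel_measurable (F (Suc n)) \<and> integrable M (\<lambda>x. m (Suc n) x powr p) \<and>
      (\<integral>x. m (Suc n) x powr p \<partial>M) \<le> ?q * (\<integral>x. norm (Y x) * m (Suc n) x powr (p - 1) \<partial>M)"
      by (simp add: m_last[abs_def])
  next
    fix k assume k: "1 \<le> k" "k < Suc n"
      and IH: "m (Suc k) \<in> borel_measurable (F (Suc k)) \<and> integrable M (\<lambda>x. m (Suc k) x powr p) \<and>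
        (\<integral>x. m (Suc k) x powr p \<partial>M) \<le> ?q * (\<integral>x. norm (Y x) * m (Suc k) x powr (p - 1) \<partial>M)"
    interpret sigma_finite_subalgebra M "F k" by (rule sigma_finite_subalgebra[OF F[OF k(1)]])
    have kn: "k \<le> n" using k by simp
    have Zk: "is_cond_exp M (F k) Y (Z k)" by (rule Z[OF k(1) kn])
    have sub: "subalgebra (F k) (F (Suc k))"
      using F[of k] F[of "Suc k"] dec[of k] k by (auto simp: subalgebra_def)
    have ZF [measurable]: "Z k \<in> borel_measurable (F k)" using Zk by (simp add: is_cond_exp_def)
    have m1F [measurable]: "m (Suc k) \<in> borel_measurable (F k)"
      using measurable_from_subalg[OF sub] IH by blast
    have meq: "m k = (\<lambda>x. max (norm (Z k x)) (m (Suc k) x))" using m_rec[OF kn] by auto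
    have mF [measurable]: "m k \<in> borel_measurable (F k)" unfolding meq by measurable
    note toM = measurable_from_subalg[OF F[OF k(1)]]
    note [measurable] = toM[OF ZF] toM[OF m1F] toM[OF mF]
    have m1p: "integrable M (\<lambda>x. m (Suc k) x powr p)" using IH by blast
    have mp: "integrable M (\<lambda>x. m k x powr p)"
    proof -
      have "m k x powr p = max (norm (Z k x) powr p) (m (Suc k) x powr p)" for x
        using p m0[of "Suc k" x] by (auto simp: meq max_def powr_mono2 intro!: antisym powr_mono2)
      then show ?thesis using integrable_max[OF Zp[OF k(1) kn] m1p] by simp
    qed
    \<comment> \<open>Summation by parts: \<open>D\<close> is \<open>F k\<close>-measurable, so \<open>Z k\<close> may be replaced by \<open>Y\<close> and the sum telescopes.\<close>
    define D where "D x = m k x powr (p - 1) - m (Suc k) x powr (p - 1)" for x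
    have [measurable]: "D \<in> borel_measurable (F k)" unfolding D_def by measurable
    have D0: "0 \<le> D x" for x
      unfolding D_def meq using p m0[of "Suc k" x] by (simp add: powr_mono2)
    let ?R = "real_cond_exp M (F k) (\<lambda>x. norm (Y x))"
    have YD: "integrable M (\<lambda>x. D x * norm (Y x))"
      and YDeq: "(\<integral>x. D x * norm (Y x) \<partial>M) = (\<integral>x. norm (Y x) * m k x powr (p - 1) \<partial>M) - (\<integral>x. norm (Y x) * m (Suc k) x powr (p - 1) \<partial>M)"
      and ZD: "integrable M (\<lambda>x. norm (Z k x) * D x)"
    proof -
      have a: "integrable M (\<lambda>x. f x * m k x powr (p - 1))" "integrable M (\<lambda>x. f x * m (Suc k) x powr (p - 1))"
        if "f \<in> borel_measurable M" "\<And>x. 0 \<le> f x" "integrable M (\<lambda>x. f x powr p)" for f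
        using that mp m1p m0 by (auto intro!: integrable_mult_powr[OF p])
      note aY = a[of "\<lambda>x. norm (Y x)", OF _ _ int, simplified]
      note aZ = a[of "\<lambda>x. norm (Z k x)", OF _ _ Zp[OF k(1) kn], simplified]
      have "(\<lambda>x. D x * norm (Y x)) = (\<lambda>x. norm (Y x) * m k x powr (p - 1) - norm (Y x) * m (Suc k) x powr (p - 1))"
        by (auto simp: D_def algebra_simps)
      then show "integrable M (\<lambda>x. D x * norm (Y x))"
        "(\<integral>x. D x * norm (Y x) \<partial>M) = (\<integral>x. norm (Y x) * m k x powr (p - 1) \<partial>M) - (\<integral>x. norm (Y x) * m (Suc k) x powr (p - 1) \<partial>M)"
        using aY by auto
      show "integrable M (\<lambda>x. norm (Z k x) * D x)"
        using aZ by (simp add: D_def algebra_simps)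
    qed
    have RD: "integrable M (\<lambda>x. D x * ?R x)" and RDeq: "(\<integral>x. D x * ?R x \<partial>M) = (\<integral>x. D x * norm (Y x) \<partial>M)"
      using real_cond_exp_intg[OF YD] by auto
    have ZR: "(\<integral>x. norm (Z k x) * D x \<partial>M) \<le> (\<integral>x. D x * ?R x \<partial>M)"
      by (rule integral_mono_AE[OF ZD RD])
         (use is_cond_exp_seminorm_le[OF F[OF k(1)] Zk bounded_seminorm_norm] D0
           in \<open>auto elim!: eventually_mono simp: mult.commute[of "D _"] mult_right_mono\<close>)
    have "(\<integral>x. m k x powr p \<partial>M) \<le> (\<integral>x. m (Suc k) x powr p + ?q * (norm (Z k x) * D x) \<partial>M)"
    proof (rule integral_mono[OF mp])
      show "m k x powr p \<le> m (Suc k) x powr p + ?q * (norm (Z k x) * D x)" for x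
        using max_powr_diff_le[OF p m0[of "Suc k" x], of "norm (Z k x)"] by (simp add: D_def meq)
    qed (use m1p ZD in auto)
    also have "\<dots> = (\<integral>x. m (Suc k) x powr p \<partial>M) + ?q * (\<integral>x. norm (Z k x) * D x \<partial>M)"
      using m1p ZD by simp
    also have "\<dots> \<le> ?q * (\<integral>x. norm (Y x) * m (Suc k) x powr (p - 1) \<partial>M) + ?q * (\<integral>x. D x * norm (Y x) \<partial>M)"
      using IH ZR RDeq q by (intro add_mono mult_left_mono) auto
    also have "\<dots> = ?q * (\<integral>x. norm (Y x) * m k x powr (p - 1) \<partial>M)"
      by (simp add: YDeq algebra_simps)
    finally show "m k \<in> borel_measurable (F k) \<and> integrable M (\<lambda>x. m k x powr p) \<and>
        (\<integral>x. m k x powr p \<partial>M) \<le> ?q * (\<integral>x. norm (Y x) * m k x powr (p - 1) \<partial>M)"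
      using mF mp by blast
  qed simp
  then have m1F: "m 1 \<in> borel_measurable (F 1)" and mp: "integrable M (\<lambda>x. m 1 x powr p)"
    and le: "(\<integral>x. m 1 x powr p \<partial>M) \<le> ?q * (\<integral>x. norm (Y x) * m 1 x powr (p - 1) \<partial>M)"
    by blast+
  have mM: "m 1 \<in> borel_measurable M" by (rule measurable_from_subalg[OF F m1F]) simp
  let ?A = "\<integral>x. m 1 x powr p \<partial>M" and ?B = "\<integral>x. norm (Y x) powr p \<partial>M"
  note le
  also have "?q * (\<integral>x. norm (Y x) * m 1 x powr (p - 1) \<partial>M) = (\<integral>x. ?q * (norm (Y x) * m 1 x powr (p - 1)) \<partial>M)"
    by simp
  \<comment> \<open>Young's inequality is applied to \<open>?q * norm (Y x)\<close>, factor
    included. The term \<open>(1 - 1 / p) * ?A\<close> is then absorbed on the left, which is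
    legitimate as \<open>m 1 x powr p\<close> is integrable; what remains has the constant
    \<open>?q powr p\<close>.\<close>
  also have "\<dots> \<le> (\<integral>x. ?q powr p * norm (Y x) powr p / p + (1 - 1 / p) * m 1 x powr p \<partial>M)"
  proof (rule integral_mono)
    show "integrable M (\<lambda>x. ?q * (norm (Y x) * m 1 x powr (p - 1)))"
      by (intro integrable_mult_right integrable_mult_powr[OF p _ mM _ int m0 mp]) auto
    show "?q * (norm (Y x) * m 1 x powr (p - 1)) \<le> ?q powr p * norm (Y x) powr p / p + (1 - 1 / p) * m 1 x powr p" for x
      using Youngs_inequality_powr[OF p mult_nonneg_nonneg[OF less_imp_le[OF q] norm_ge_zero] m0, of "Y x" 1 x]
      by (simp only: powr_mult mult.assoc)
  qed (use int mp in auto)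
  also have "\<dots> = ?q powr p * ?B / p + (1 - 1 / p) * ?A"
    using int mp by simp
  finally have "?A / p \<le> ?q powr p * ?B / p" by (simp add: algebra_simps)
  then have AB: "?A \<le> ?q powr p * ?B" using p by (simp add: divide_le_cancel)
  have "(\<integral>x. (MAX k\<in>{1..n}. norm (Z k x) powr p) \<partial>M) \<le> ?A"
  proof (rule integral_mono[OF I mp])
    fix x
    have "norm (Z k x) powr p \<le> m 1 x powr p" if "k \<in> {1..n}" for k
    proof (rule powr_mono2)
      show "norm (Z k x) \<le> m 1 x" unfolding m_def using that by (intro Max_ge) auto
    qed (use p in auto)
    then show "(MAX k\<in>{1..n}. norm (Z k x) powr p) \<le> m 1 x powr p"
      using n by (intro Max.boundedI) auto
  qed
  with AB show "(\<integral>x. (MAX k\<in>{1..n}. norm (Z k x) powr p) \<partial>M) \<le> ?q powr p * ?B" by linarith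
qed

text \<open>The shared estimate: \<open>U k\<close> is the conditional expectation of the
  \<open>k\<close>-th partial sum, and \<open>Y\<close> is the last partial sum in one part and the
  martingale T in the other. In \<open>1 + (p / (p - 1)) powr p\<close> the \<open>1\<close> pays
  for \<open>Y\<close> itself, the other summand for its conditional expectations.\<close>

lemma maximal_powr_le:
  fixes Y :: "'a \<Rightarrow> 'b::{banach, second_countable_topology}"
    and S U :: "nat \<Rightarrow> 'a \<Rightarrow> 'c::real_normed_vector"
  assumes p: "1 < p"
    and F: "\<And>k. 1 \<le> k \<Longrightarrow> subalgebra M (F k)"
    and dec: "\<And>k. 1 \<le> k \<Longrightarrow> sets (F (Suc k)) \<subseteq> sets (F k)"
    and Z: "\<And>k. 1 \<le> k \<Longrightarrow> k \<le> n \<Longrightarrow> is_cond_exp M (F k) Y (Z k)"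
    and int: "integrable M (\<lambda>x. norm (Y x) powr p)"
    and U: "\<And>k. 1 \<le> k \<Longrightarrow> k \<le> n \<Longrightarrow> integrable M (\<lambda>x. norm (U k x) powr p)"
    and n: "1 \<le> n"
    and le: "\<And>k. 1 \<le> k \<Longrightarrow> k \<le> n \<Longrightarrow> AE x in M. norm (S k x) \<le> norm (U k x) + norm (Y x) + norm (Z k x)"
  shows "(\<integral>x. (MAX k\<in>{1..n}. norm (S k x) powr p) \<partial>M) \<le>
    3 powr (p - 1) * ((\<integral>x. (MAX k\<in>{1..n}. norm (U k x) powr p) \<partial>M)
      + (1 + (p / (p - 1)) powr p) * (\<integral>x. norm (Y x) powr p \<partial>M))"
proof -
  let ?MU = "\<lambda>x. MAX k\<in>{1..n}. norm (U k x) powr p"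
  let ?MZ = "\<lambda>x. MAX k\<in>{1..n}. norm (Z k x) powr p"
  let ?C = "3 powr (p - 1) :: real"
  have iU: "integrable M ?MU" by (rule integrable_MAX) (use n U in auto)
  note Z' = reversed_Doob_maximal_powr[where F = F and Y = Y and Z = Z, OF p F dec Z int n]
  have "AE x in M. \<forall>k\<in>{1..n}. norm (S k x) \<le> norm (U k x) + norm (Y x) + norm (Z k x)"
    by (rule AE_finite_allI) (use le in auto)
  then have ae: "AE x in M. (MAX k\<in>{1..n}. norm (S k x) powr p) \<le> ?C * (?MU x + norm (Y x) powr p + ?MZ x)"
  proof eventually_elim
    case (elim x)
    have "norm (S k x) powr p \<le> ?C * (?MU x + norm (Y x) powr p + ?MZ x)" if k: "k \<in> {1..n}" for k
    proof -
      have "norm (S k x) powr p \<le> (norm (U k x) + norm (Y x) + norm (Z k x)) powr p"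
        using elim k p by (intro powr_mono2) auto
      also have "\<dots> \<le> ?C * (norm (U k x) powr p + norm (Y x) powr p + norm (Z k x) powr p)"
        by (rule powr_add3_le) (use p in auto)
      also have "\<dots> \<le> ?C * (?MU x + norm (Y x) powr p + ?MZ x)"
        using k by (intro mult_left_mono add_mono Max_ge) auto
      finally show ?thesis .
    qed
    then show ?case using n by (intro Max.boundedI) auto
  qed
  have nn: "0 \<le> (MAX k\<in>{1..n}. norm (S k x) powr p)" for x
    using n by (intro Max_ge_iff[THEN iffD2]) (auto intro!: bexI[of _ 1])
  \<comment> \<open>This form of monotonicity asks for integrability of the nonnegative majorant
    only: a nonintegrable left side has integral \<open>0\<close>.\<close>
  have "(\<integral>x. (MAX k\<in>{1..n}. norm (S k x) powr p) \<partial>M) \<le> (\<integral>x. ?C * (?MU x + norm (Y x) powr p + ?MZ x) \<partial>M)"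
  proof (rule integral_mono_AE'[OF _ ae])
    show "AE x in M. 0 \<le> ?C * (?MU x + norm (Y x) powr p + ?MZ x)"
      using ae by eventually_elim (rule order_trans[OF nn])
  qed (use iU int Z'(1) in auto)
  also have "\<dots> = ?C * ((\<integral>x. ?MU x \<partial>M) + (\<integral>x. norm (Y x) powr p \<partial>M) + (\<integral>x. ?MZ x \<partial>M))"
    using iU int Z'(1) by simp
  also have "\<dots> \<le> ?C * ((\<integral>x. ?MU x \<partial>M) + (\<integral>x. norm (Y x) powr p \<partial>M) + (p / (p - 1)) powr p * (\<integral>x. norm (Y x) powr p \<partial>M))"
    using Z'(2) by (intro mult_left_mono add_left_mono) auto
  finally show ?thesis by (simp add: algebra_simps)
qed

end

subsection \<open>Martingale differences in smooth spaces\<close>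

lemma bounded_seminorm_equivalent_norm: "equivalent_norm a b N \<Longrightarrow> bounded_seminorm N b"
  by (auto simp: equivalent_norm_def bounded_seminorm_def)

lemma (in bounded_seminorm) integrable_powr_add:
  assumes p: "1 \<le> p" and [measurable]: "f \<in> borel_measurable M" "g \<in> borel_measurable M"
    and "integrable M (\<lambda>x. N (f x) powr p)" "integrable M (\<lambda>x. N (g x) powr p)"
  shows "integrable M (\<lambda>x. N (f x + g x) powr p)"
proof (rule Bochner_Integration.integrable_bound)
  show "integrable M (\<lambda>x. 3 powr (p - 1) * (N (f x) powr p + N (g x) powr p))"
    using assms by auto
  have "N (f x + g x) powr p \<le> 3 powr (p - 1) * (N (f x) powr p + N (g x) powr p)" for x
    using order_trans[OF powr_mono2[OF _ _ triangle, of p "f x" "g x"] powr_add3_le[OF p, of "N (f x)" "N (g x)" 0, simplified]] p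
    by simp
  then show "AE x in M. norm (N (f x + g x) powr p) \<le> norm (3 powr (p - 1) * (N (f x) powr p + N (g x) powr p))"
    by (intro AE_I2) (auto intro: order_trans[OF _ abs_ge_self])
qed measurable

lemma (in bounded_seminorm) integrable_powr_diff:
  assumes "1 \<le> p" "f \<in> borel_measurable M" "g \<in> borel_measurable M"
    and "integrable M (\<lambda>x. N (f x) powr p)" "integrable M (\<lambda>x. N (g x) powr p)"
  shows "integrable M (\<lambda>x. N (f x - g x) powr p)"
  using integrable_powr_add[of p f M "\<lambda>x. - g x"] assms by (simp add: minus)

lemma (in bounded_seminorm) integrable_powr_of_norm:
  assumes p: "0 \<le> p" and [measurable]: "f \<in> borel_measurable M"
    and int: "integrable M (\<lambda>x. norm (f x) powr p)"
  shows "integrable M (\<lambda>x. N (f x) powr p)"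
proof (rule Bochner_Integration.integrable_bound)
  show "integrable M (\<lambda>x. \<bar>b\<bar> powr p * norm (f x) powr p)" using int by simp
  have "N (f x) powr p \<le> (\<bar>b\<bar> * norm (f x)) powr p" for x
    using p by (intro powr_mono2 order_trans[OF bound] mult_right_mono) auto
  then show "AE x in M. norm (N (f x) powr p) \<le> norm (\<bar>b\<bar> powr p * norm (f x) powr p)"
    by (intro AE_I2) (simp add: powr_mult)
qed measurable

text \<open>Follows from \<open>y \<le> 1 + y powr p\<close>, the constant \<open>1\<close> being
  integrable for a probability measure.\<close>

lemma (in prob_space) integrable_of_norm_powr:
  fixes f :: "'a \<Rightarrow> 'b::{banach, second_countable_topology}"
  assumes p: "1 \<le> p" and [measurable]: "f \<in> borel_measurable M"
    and int: "integrable M (\<lambda>x. norm (f x) powr p)"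
  shows "integrable M f"
proof (rule Bochner_Integration.integrable_bound)
  show "integrable M (\<lambda>x. 1 + norm (f x) powr p)" using int by simp
  have "y \<le> 1 + y powr p" if "0 \<le> y" for y :: real
  proof (cases "y \<le> 1")
    case False
    then have "y powr 1 \<le> y powr p" using p by (intro powr_mono) auto
    then show ?thesis using that False by simp
  qed (simp add: add_increasing2)
  then show "AE x in M. norm (f x) \<le> norm (1 + norm (f x) powr p)"
    by (intro AE_I2) simp
qed measurable

context prob_space
begin

text \<open>Doubling the two-point inequality produces E N(T)^r twice, and Jensen's lower bound for
  E N(T - D)^r cancels one copy. The coefficient of E N(T)^r thus stays \<open>1\<close>, so
  iterating the step does not compound the constant.\<close>

lemma smooth_norm_martingale_step:
  fixes T D :: "'a \<Rightarrow> 'b::{banach, second_countable_topology}"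
  assumes r: "1 \<le> r" "r \<le> 2" and eq: "equivalent_norm a b N" and sm: "smooth_norm r K N"
    and G: "subalgebra M G" and T: "integrable M T" "T \<in> borel_measurable G"
    and D: "is_cond_exp M G D (\<lambda>_. 0)"
    and Tr: "integrable M (\<lambda>x. N (T x) powr r)" and Dr: "integrable M (\<lambda>x. N (D x) powr r)"
  shows "(\<integral>x. N (T x + D x) powr r \<partial>M) \<le>
    (\<integral>x. N (T x) powr r \<partial>M) + (8 + 4 * K + 4 * K\<^sup>2) * (\<integral>x. N (D x) powr r \<partial>M)"
proof -
  have bN: "bounded_seminorm N b" by (rule bounded_seminorm_equivalent_norm[OF eq])
  interpret N: bounded_seminorm N b by (rule bN)
  have Di: "integrable M D" using D by (simp add: is_cond_exp_def)
  have plus: "integrable M (\<lambda>x. N (T x + D x) powr r)" and minus: "integrable M (\<lambda>x. N (T x - D x) powr r)"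
    using N.integrable_powr_add[OF r(1) _ _ Tr Dr] N.integrable_powr_diff[OF r(1) _ _ Tr Dr] T Di by auto
  have "is_cond_exp M G (\<lambda>x. T x - D x) T"
    using is_cond_exp_diff[OF G is_cond_exp_self[OF T] D] by simp
  from is_cond_exp_seminorm_powr(2)[OF G this bN r(1) minus]
  have J: "(\<integral>x. N (T x) powr r \<partial>M) \<le> (\<integral>x. N (T x - D x) powr r \<partial>M)" .
  have "(\<integral>x. N (T x + D x) powr r \<partial>M) \<le>
      (\<integral>x. 2 * N (T x) powr r + (8 + 4 * K + 4 * K\<^sup>2) * N (D x) powr r - N (T x - D x) powr r \<partial>M)"
  proof (rule integral_mono[OF plus])
    show "N (T x + D x) powr r \<le>
        2 * N (T x) powr r + (8 + 4 * K + 4 * K\<^sup>2) * N (D x) powr r - N (T x - D x) powr r" for x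
      using smooth_norm_two_point[OF r eq sm, of "T x" "D x"] by (simp add: algebra_simps)
  qed (use Tr Dr minus in auto)
  also have "\<dots> = 2 * (\<integral>x. N (T x) powr r \<partial>M) + (8 + 4 * K + 4 * K\<^sup>2) * (\<integral>x. N (D x) powr r \<partial>M)
      - (\<integral>x. N (T x - D x) powr r \<partial>M)"
    using Tr Dr minus by simp
  finally show ?thesis using J by linarith
qed

text \<open>Downward induction from the empty sum at \<open>k = n\<close>. Measurability for
  \<open>F k\<close> and integrability of the tail are carried along because the next step needs
  them.\<close>

lemma smooth_norm_martingale_sum:
  fixes D :: "nat \<Rightarrow> 'a \<Rightarrow> 'b::{banach, second_countable_topology}"
  assumes r: "1 \<le> r" "r \<le> 2" and eq: "equivalent_norm a b N" and sm: "smooth_norm r K N"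
    and F: "\<And>k. 1 \<le> k \<Longrightarrow> subalgebra M (F k)"
    and dec: "\<And>k. 1 \<le> k \<Longrightarrow> sets (F (Suc k)) \<subseteq> sets (F k)"
    and D: "\<And>i. 1 \<le> i \<Longrightarrow> D i \<in> borel_measurable (F i)"
    and D0: "\<And>i. 1 \<le> i \<Longrightarrow> is_cond_exp M (F (Suc i)) (D i) (\<lambda>_. 0)"
    and Dr: "\<And>i. 1 \<le> i \<Longrightarrow> integrable M (\<lambda>x. N (D i x) powr r)"
    and n: "1 \<le> n"
  shows "(\<integral>x. N (\<Sum>i\<in>{1..<n}. D i x) powr r \<partial>M) \<le>
    (8 + 4 * K + 4 * K\<^sup>2) * (\<Sum>i\<in>{1..<n}. \<integral>x. N (D i x) powr r \<partial>M)"
proof -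
  interpret N: bounded_seminorm N b by (rule bounded_seminorm_equivalent_norm[OF eq])
  let ?c = "8 + 4 * K + 4 * K\<^sup>2"
  let ?T = "\<lambda>k x. \<Sum>i\<in>{k..<n}. D i x"
  have "?T 1 \<in> borel_measurable (F 1) \<and> integrable M (?T 1) \<and> integrable M (\<lambda>x. N (?T 1 x) powr r)
    \<and> (\<integral>x. N (?T 1 x) powr r \<partial>M) \<le> ?c * (\<Sum>i\<in>{1..<n}. \<integral>x. N (D i x) powr r \<partial>M)"
  proof (rule inc_induct[where i = 1 and j = n])
    fix k assume k: "1 \<le> k" "k < n" and
      IH: "?T (Suc k) \<in> borel_measurable (F (Suc k)) \<and> integrable M (?T (Suc k)) \<and> integrable M (\<lambda>x. N (?T (Suc k) x) powr r)
        \<and> (\<integral>x. N (?T (Suc k) x) powr r \<partial>M) \<le> ?c * (\<Sum>i\<in>{Suc k..<n}. \<integral>x. N (D i x) powr r \<partial>M)"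
    have sub: "subalgebra (F k) (F (Suc k))"
      using F[of k] F[of "Suc k"] dec[of k] k by (auto simp: subalgebra_def)
    have ins: "{k..<n} = insert k {Suc k..<n}" using k by auto
    have T': "?T k x = ?T (Suc k) x + D k x" for x by (simp add: ins add.commute)
    then have T: "?T k = (\<lambda>x. ?T (Suc k) x + D k x)" by blast
    have m: "?T (Suc k) \<in> borel_measurable (F k)" using measurable_from_subalg[OF sub] IH by blast
    have Dk: "integrable M (D k)" using D0[OF k(1)] by (simp add: is_cond_exp_def)
    have 1: "?T k \<in> borel_measurable (F k)" unfolding T using m D[OF k(1)] by (rule borel_measurable_add)
    have 2: "integrable M (?T k)" unfolding T using IH Dk by (intro Bochner_Integration.integrable_add) blast+
    have 3: "integrable M (\<lambda>x. N (?T k x) powr r)"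
      unfolding T' using IH Dk Dr[OF k(1)] by (intro N.integrable_powr_add r borel_measurable_integrable) blast+
    have "(\<integral>x. N (?T k x) powr r \<partial>M) \<le> (\<integral>x. N (?T (Suc k) x) powr r \<partial>M) + ?c * (\<integral>x. N (D k x) powr r \<partial>M)"
      unfolding T'
      by (rule smooth_norm_martingale_step[OF r eq sm F[of "Suc k"] _ _ D0[OF k(1)] _ Dr[OF k(1)]])
         (use IH in auto)
    also have "\<dots> \<le> ?c * (\<Sum>i\<in>{Suc k..<n}. \<integral>x. N (D i x) powr r \<partial>M) + ?c * (\<integral>x. N (D k x) powr r \<partial>M)"
      using IH by simp
    also have "\<dots> = ?c * (\<Sum>i\<in>{k..<n}. \<integral>x. N (D i x) powr r \<partial>M)"
      unfolding ins by (simp add: algebra_simps)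
    finally show "?T k \<in> borel_measurable (F k) \<and> integrable M (?T k) \<and> integrable M (\<lambda>x. N (?T k x) powr r)
      \<and> (\<integral>x. N (?T k x) powr r \<partial>M) \<le> ?c * (\<Sum>i\<in>{k..<n}. \<integral>x. N (D i x) powr r \<partial>M)"
      using 1 2 3 by blast
  qed (use n in auto)
  then show ?thesis by blast
qed

text \<open>Every admissible norm gives the bound with its own constant. Dividing by the right-hand
  sum passes to the infimum; if that sum is \<open>0\<close>, any one admissible constant
  suffices.\<close>

lemma smooth_space_martingale_sum:
  fixes D :: "nat \<Rightarrow> 'a \<Rightarrow> 'b::{banach, second_countable_topology}"
  assumes sp: "smooth_space TYPE('b) r"
    and F: "\<And>k. 1 \<le> k \<Longrightarrow> subalgebra M (F k)"
    and dec: "\<And>k. 1 \<le> k \<Longrightarrow> sets (F (Suc k)) \<subseteq> sets (F k)"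
    and D: "\<And>i. 1 \<le> i \<Longrightarrow> D i \<in> borel_measurable (F i)"
    and D0: "\<And>i. 1 \<le> i \<Longrightarrow> is_cond_exp M (F (Suc i)) (D i) (\<lambda>_. 0)"
    and Dr: "\<And>i. 1 \<le> i \<Longrightarrow> integrable M (\<lambda>x. norm (D i x) powr r)"
    and n: "1 \<le> n"
  shows "(\<integral>x. norm (\<Sum>i\<in>{1..<n}. D i x) powr r \<partial>M) \<le>
    martingale_type_const TYPE('b) r * (\<Sum>i\<in>{1..<n}. \<integral>x. norm (D i x) powr r \<partial>M)"
proof -
  have r: "1 \<le> r" "r \<le> 2" using sp by (auto simp: smooth_space_def)
  let ?I = "\<integral>x. norm (\<Sum>i\<in>{1..<n}. D i x) powr r \<partial>M"
  let ?s = "\<Sum>i\<in>{1..<n}. \<integral>x. norm (D i x) powr r \<partial>M"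
  have Di: "integrable M (D i)" if "1 \<le> i" for i
    using D0[OF that] by (simp add: is_cond_exp_def)
  have s0: "0 \<le> ?s" by (intro sum_nonneg) simp
  have le: "?I \<le> (b / a) powr r * (8 + 4 * K + 4 * K\<^sup>2) * ?s"
    if eq: "equivalent_norm a b N" and sm: "smooth_norm r K N" for N :: "'b \<Rightarrow> real" and a b K
  proof -
    interpret N: bounded_seminorm N b by (rule bounded_seminorm_equivalent_norm[OF eq])
    have a: "0 < a" and b: "0 < b" and lo: "\<And>x. a * norm x \<le> N x"
      using eq by (auto simp: equivalent_norm_def)
    have c0: "0 \<le> 8 + 4 * K + 4 * K\<^sup>2" using smooth_const_ge[of K] by linarith
    have DN: "integrable M (\<lambda>x. N (D i x) powr r)" if "1 \<le> i" for i
      by (rule N.integrable_powr_of_norm) (use r Di[OF that] Dr[OF that] in auto)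
    let ?T = "\<lambda>x. \<Sum>i\<in>{1..<n}. D i x"
    have Ti: "integrable M ?T" using Di by auto
    have TN: "integrable M (\<lambda>x. N (?T x) powr r)"
    proof -
      have "integrable M (\<lambda>x. N (\<Sum>i\<in>J. D i x) powr r)" if "finite J" "J \<subseteq> {1..<n}" for J
        using that
      proof (induction J rule: finite_induct)
        case (insert j J)
        have "integrable M (\<lambda>x. \<Sum>i\<in>J. D i x)" using Di insert.prems by (intro Bochner_Integration.integrable_sum) auto
        then show ?case
          using insert DN[of j] Di[of j] by (auto intro!: N.integrable_powr_add r)
      qed simp
      then show ?thesis by blast
    qed
    have Tn: "?I \<le> (\<integral>x. N (?T x) powr r / a powr r \<partial>M)"
    proof (rule integral_mono_AE')
      have "norm y powr r \<le> N y powr r / a powr r" for y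
      proof -
        have "(a * norm y) powr r \<le> N y powr r" using lo a r by (intro powr_mono2) auto
        then show ?thesis using a by (simp add: powr_mult field_simps)
      qed
      then show "AE x in M. norm (?T x) powr r \<le> N (?T x) powr r / a powr r" by simp
    qed (use TN in auto)
    also have "\<dots> = (\<integral>x. N (?T x) powr r \<partial>M) / a powr r" by simp
    also have "\<dots> \<le> ((8 + 4 * K + 4 * K\<^sup>2) * (\<Sum>i\<in>{1..<n}. \<integral>x. N (D i x) powr r \<partial>M)) / a powr r"
      by (intro divide_right_mono smooth_norm_martingale_sum[where F = F and D = D, OF r eq sm F dec D D0 DN n]) auto
    also have "\<dots> \<le> ((8 + 4 * K + 4 * K\<^sup>2) * (b powr r * ?s)) / a powr r"
    proof (intro divide_right_mono mult_left_mono c0)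
      have "(\<integral>x. N (D i x) powr r \<partial>M) \<le> b powr r * (\<integral>x. norm (D i x) powr r \<partial>M)" if "i \<in> {1..<n}" for i
      proof -
        have "(\<integral>x. N (D i x) powr r \<partial>M) \<le> (\<integral>x. b powr r * norm (D i x) powr r \<partial>M)"
        proof (rule integral_mono)
          fix x
          have "N (D i x) powr r \<le> (b * norm (D i x)) powr r"
            using r by (intro powr_mono2 N.bound) auto
          then show "N (D i x) powr r \<le> b powr r * norm (D i x) powr r"
            using b by (simp add: powr_mult)
        qed (use DN Dr that in auto)
        then show ?thesis by simp
      qed
      then show "(\<Sum>i\<in>{1..<n}. \<integral>x. N (D i x) powr r \<partial>M) \<le> b powr r * ?s"
        unfolding sum_distrib_left by (rule sum_mono)
    qed simp
    also have "\<dots> = (b / a) powr r * (8 + 4 * K + 4 * K\<^sup>2) * ?s"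
      using a b by (simp add: powr_divide)
    finally show ?thesis .
  qed
  let ?C = "{(b / a) powr r * (8 + 4 * K + 4 * K\<^sup>2) | (N :: 'b \<Rightarrow> real) a b K.
            equivalent_norm a b N \<and> smooth_norm r K N}"
  have C: "?I \<le> c * ?s" if "c \<in> ?C" for c using that le by blast
  have ne: "?C \<noteq> {}" using sp unfolding smooth_space_def by blast
  show ?thesis
  proof (cases "?s = 0")
    case True
    then show ?thesis using C ne by fastforce
  next
    case False
    then have s: "0 < ?s" using s0 by linarith
    have "?I / ?s \<le> Inf ?C"
      by (rule cInf_greatest[OF ne]) (use C s in \<open>simp add: pos_divide_le_eq\<close>)
    then show ?thesis unfolding martingale_type_const_def using s by (simp add: pos_divide_le_eq)
  qed
qed

end

text \<open>A nonzero vector forces \<open>a \<le> b\<close>, and the other factor is at least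
  \<open>7\<close>. On the trivial space \<open>b / a\<close> can be arbitrarily small. The bound
  lets the constant also multiply the terms that do not come from the martingale estimate.\<close>

lemma martingale_type_const_ge_1:
  assumes sp: "smooth_space TYPE('b::real_normed_vector) r" and x: "(x :: 'b) \<noteq> 0"
  shows "1 \<le> martingale_type_const TYPE('b) r"
  unfolding martingale_type_const_def
proof (rule cInf_greatest)
  show "{(b / a) powr r * (8 + 4 * K + 4 * K\<^sup>2) | (N :: 'b \<Rightarrow> real) a b K.
            equivalent_norm a b N \<and> smooth_norm r K N} \<noteq> {}"
    using sp unfolding smooth_space_def by blast
  fix c assume "c \<in> {(b / a) powr r * (8 + 4 * K + 4 * K\<^sup>2) | (N :: 'b \<Rightarrow> real) a b K.
            equivalent_norm a b N \<and> smooth_norm r K N}"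
  then obtain N :: "'b \<Rightarrow> real" and a b K
    where c: "c = (b / a) powr r * (8 + 4 * K + 4 * K\<^sup>2)" and eq: "equivalent_norm a b N" by blast
  have a: "0 < a" and "a * norm x \<le> N x" "N x \<le> b * norm x"
    using eq unfolding equivalent_norm_def by blast+
  then have "a * norm x \<le> b * norm x" by linarith
  then have "1 \<le> b / a" using x a by (simp add: field_simps)
  then have "1 \<le> (b / a) powr r"
    using sp by (intro ge_one_powr_ge_zero) (auto simp: smooth_space_def)
  then have "1 * 1 \<le> (b / a) powr r * (8 + 4 * K + 4 * K\<^sup>2)"
    using smooth_const_ge[of K] by (intro mult_mono) auto
  then show "1 \<le> c" using c by simp
qed

subsection \<open>Partial sums adapted to a decreasing filtration\<close>

locale adapted_partial_sums = prob_space M for M :: "'a measure" +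
  fixes F :: "nat \<Rightarrow> 'a measure"
    and X :: "nat \<Rightarrow> 'a \<Rightarrow> 'b::{banach, second_countable_topology}"
    and p :: real
  assumes F: "\<And>k. k \<ge> 1 \<Longrightarrow> subalgebra M (F k)"
    and dec: "\<And>k. k \<ge> 1 \<Longrightarrow> sets (F (Suc k)) \<subseteq> sets (F k)"
    and X: "\<And>j. j \<ge> 1 \<Longrightarrow> X j \<in> borel_measurable (F j)"
    and p1: "1 \<le> p"
    and Xp: "\<And>j. j \<ge> 1 \<Longrightarrow> integrable M (\<lambda>x. norm (X j x) powr p)"
begin

lemma sets_F_antimono:
  assumes "1 \<le> k" "k \<le> l"
  shows "sets (F l) \<subseteq> sets (F k)"
  using assms(2)
proof (induction l rule: dec_induct)
  case (step l)
  then show ?case using dec[of l] assms(1) by auto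
qed simp

lemma subalgebra_F: "1 \<le> k \<Longrightarrow> k \<le> l \<Longrightarrow> subalgebra (F k) (F l)"
  using F[of k] F[of l] sets_F_antimono[of k l] by (auto simp: subalgebra_def)

lemma measurable_X_F: "1 \<le> k \<Longrightarrow> k \<le> j \<Longrightarrow> X j \<in> borel_measurable (F k)"
  using measurable_from_subalg[OF subalgebra_F X] by simp

lemma measurable_X: "1 \<le> j \<Longrightarrow> X j \<in> borel_measurable M"
  by (rule measurable_from_subalg[OF F X])

lemma measurable_partial_sum: "partial_sum X k \<in> borel_measurable M"
  unfolding partial_sum_def by (rule borel_measurable_sum) (use measurable_X in auto)

lemma integrable_X: "1 \<le> j \<Longrightarrow> integrable M (X j)"
  by (rule integrable_of_norm_powr[OF p1 measurable_X Xp])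

lemma integrable_partial_sum_powr: "integrable M (\<lambda>x. norm (partial_sum X k x) powr p)"
proof (induction k)
  case (Suc k)
  interpret nrm: bounded_seminorm "norm :: 'b \<Rightarrow> real" 1 by (rule bounded_seminorm_norm)
  have "partial_sum X (Suc k) x = partial_sum X k x + X (Suc k) x" for x
    by (simp add: partial_sum_def)
  then show ?case
    using nrm.integrable_powr_add[OF p1 measurable_partial_sum measurable_X Suc, of "Suc k"] Xp by simp
qed (use p1 in \<open>simp add: partial_sum_def\<close>)

lemma integrable_partial_sum: "integrable M (partial_sum X k)"
  by (rule integrable_of_norm_powr[OF p1 measurable_partial_sum integrable_partial_sum_powr])

lemma is_cond_exp_partial_sum: "1 \<le> k \<Longrightarrow> is_cond_exp M (F k) (partial_sum X i) (cond_exp M (F k) (partial_sum X i))"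
  by (rule is_cond_exp_cond_exp[OF F integrable_partial_sum])

lemma integrable_cond_exp_powr: "1 \<le> k \<Longrightarrow> integrable M (\<lambda>x. norm (cond_exp M (F k) (partial_sum X i) x) powr p)"
  by (rule is_cond_exp_seminorm_powr(1)[OF F is_cond_exp_partial_sum bounded_seminorm_norm p1 integrable_partial_sum_powr])

lemma integrable_cond_exp: "1 \<le> k \<Longrightarrow> integrable M (cond_exp M (F k) (partial_sum X i))"
  and measurable_cond_exp: "1 \<le> k \<Longrightarrow> cond_exp M (F k) (partial_sum X i) \<in> borel_measurable (F k)"
  using is_cond_exp_partial_sum by (auto simp: is_cond_exp_def)

text \<open>As X_(k+1) is measurable for \<open>F (k + 1)\<close>, it drops out of S_(k+1) - E^(k+1)
  S_(k+1), which therefore equals S_k - E^(k+1) S_k, that is, (S_k - E^k S_k) + D_k.\<close>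

lemma sum_cond_diff_decomposition:
  "1 \<le> k \<Longrightarrow> AE x in M. partial_sum X k x =
    cond_exp M (F k) (partial_sum X k) x + (\<Sum>i\<in>{1..<k}. cond_diff M F i (partial_sum X i) x)"
proof (induction k rule: dec_induct)
  case base
  have "partial_sum X 1 = X 1" by (auto simp: partial_sum_def)
  then show ?case
    using is_cond_exp_unique[OF F[of 1] is_cond_exp_self[OF integrable_X[of 1] X[of 1]] is_cond_exp_cond_exp[OF F[of 1] integrable_X[of 1]]]
    by simp
next
  case (step k)
  have S: "partial_sum X (Suc k) = (\<lambda>x. partial_sum X k x + X (Suc k) x)"
    by (auto simp: partial_sum_def)
  have "is_cond_exp M (F (Suc k)) (partial_sum X (Suc k))
      (\<lambda>x. cond_exp M (F (Suc k)) (partial_sum X k) x + X (Suc k) x)"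
    unfolding S by (intro is_cond_exp_add is_cond_exp_cond_exp is_cond_exp_self F X integrable_X integrable_partial_sum) auto
  from is_cond_exp_unique[OF _ is_cond_exp_cond_exp this] F integrable_partial_sum
  have "AE x in M. cond_exp M (F (Suc k)) (partial_sum X (Suc k)) x =
      cond_exp M (F (Suc k)) (partial_sum X k) x + X (Suc k) x" by simp
  with step.IH show ?case
  proof eventually_elim
    case (elim x)
    have "{1..<Suc k} = insert k {1..<k}" using step by auto
    then show ?case using elim by (simp add: S cond_diff_def algebra_simps)
  qed
qed

lemma maximal_partial_sum_le:
  assumes p: "1 < p" and n: "1 \<le> n"
  shows "(\<integral>x. (MAX k\<in>{1..n}. norm (partial_sum X k x) powr p) \<partial>M) \<le> max_const p *
    ((\<integral>x. (MAX k\<in>{1..n}. norm (cond_exp M (F k) (partial_sum X k) x) powr p) \<partial>M)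
      + (\<integral>x. norm (partial_sum X n x) powr p \<partial>M))"
proof -
  let ?S = "partial_sum X"
  let ?E = "\<lambda>k. cond_exp M (F k) (?S k)"
  let ?Z = "\<lambda>k. cond_exp M (F k) (?S n)"
  have Z: "is_cond_exp M (F k) (?S n) (?Z k)" if "1 \<le> k" for k
    by (rule is_cond_exp_cond_exp[OF F[OF that] integrable_partial_sum])
  have le: "AE x in M. norm (?S k x) \<le> norm (?E k x) + norm (?S n x) + norm (?Z k x)"
    if k: "1 \<le> k" "k \<le> n" for k
  proof -
    have diff: "?S n x - ?S k x = (\<Sum>j\<in>{k<..n}. X j x)" for x
    proof -
      have "{1..n} = {1..k} \<union> {k<..n}" using k by auto
      then have "?S n x = (\<Sum>j\<in>{1..k} \<union> {k<..n}. X j x)" by (simp only: partial_sum_def)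
      also have "\<dots> = ?S k x + (\<Sum>j\<in>{k<..n}. X j x)"
        unfolding partial_sum_def by (rule sum.union_disjoint) auto
      finally show ?thesis by simp
    qed
    \<comment> \<open>The fields decrease, so every \<open>X j\<close> with \<open>j > k\<close> is
      already measurable for \<open>F k\<close>: the remaining sum is its own conditional
      expectation.\<close>
    have "(\<lambda>x. ?S n x - ?S k x) \<in> borel_measurable (F k)"
      unfolding diff by (rule borel_measurable_sum) (use measurable_X_F k in auto)
    then have "is_cond_exp M (F k) (\<lambda>x. ?S n x - ?S k x) (\<lambda>x. ?S n x - ?S k x)"
      using integrable_partial_sum by (intro is_cond_exp_self) auto
    from is_cond_exp_diff[OF F[OF k(1)] Z[OF k(1)] this]
    have "is_cond_exp M (F k) (?S k) (\<lambda>x. ?Z k x - (?S n x - ?S k x))" by simp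
    from is_cond_exp_unique[OF F[OF k(1)] is_cond_exp_partial_sum[OF k(1)] this]
    show ?thesis
    proof eventually_elim
      case (elim x)
      then have "?S k x = ?E k x + ?S n x - ?Z k x" by simp
      then show ?case
        using norm_triangle_ineq4[of "?E k x + ?S n x" "?Z k x"] norm_triangle_ineq[of "?E k x" "?S n x"]
        by simp
    qed
  qed
  let ?MU = "\<integral>x. (MAX k\<in>{1..n}. norm (?E k x) powr p) \<partial>M" and ?B = "\<integral>x. norm (?S n x) powr p \<partial>M"
  let ?q = "(p / (p - 1)) powr p"
  have U0: "0 \<le> ?MU"
    using n by (intro Bochner_Integration.integral_nonneg Max_ge_iff[THEN iffD2]) (auto intro!: bexI[of _ 1])
  have "(\<integral>x. (MAX k\<in>{1..n}. norm (?S k x) powr p) \<partial>M) \<le> 3 powr (p - 1) * (?MU + (1 + ?q) * ?B)"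
    by (rule maximal_powr_le[where F = F and Z = ?Z and Y = "?S n" and S = ?S and U = ?E, OF p F dec Z integrable_partial_sum_powr integrable_cond_exp_powr n le])
  also have "\<dots> \<le> 3 powr (p - 1) * ((1 + ?q) * (?MU + ?B))"
    using U0 by (intro mult_left_mono) (auto simp: algebra_simps)
  finally show "(\<integral>x. (MAX k\<in>{1..n}. norm (?S k x) powr p) \<partial>M) \<le> max_const p * (?MU + ?B)"
    by (simp add: max_const_def mult.assoc)
qed

lemma smooth_maximal_partial_sum_le:
  assumes sp: "smooth_space TYPE('b) p" and n: "1 \<le> n"
  shows "(\<integral>x. (MAX k\<in>{1..n}. norm (partial_sum X k x) powr p) \<partial>M) \<le> smooth_max_const TYPE('b) p *
    ((\<integral>x. (MAX k\<in>{1..n}. norm (cond_exp M (F k) (partial_sum X k) x) powr p) \<partial>M)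
      + (\<Sum>i=1..n-1. \<integral>x. norm (cond_diff M F i (partial_sum X i) x) powr p \<partial>M))"
proof -
  interpret nrm: bounded_seminorm "norm :: 'b \<Rightarrow> real" 1 by (rule bounded_seminorm_norm)
  let ?S = "partial_sum X"
  let ?E = "\<lambda>k. cond_exp M (F k) (?S k)"
  let ?D = "\<lambda>i. cond_diff M F i (?S i)"
  let ?MU = "\<integral>x. (MAX k\<in>{1..n}. norm (?E k x) powr p) \<partial>M"
  let ?s = "\<Sum>i=1..n-1. \<integral>x. norm (?D i x) powr p \<partial>M"
  have idx: "{1..n - 1} = {1..<n}" using n by auto
  show "(\<integral>x. (MAX k\<in>{1..n}. norm (?S k x) powr p) \<partial>M) \<le> smooth_max_const TYPE('b) p * (?MU + ?s)"
  proof (cases "\<exists>x::'b. x \<noteq> 0")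
    \<comment> \<open>On the trivial space both sides are \<open>0\<close>; the constant need not be
      at least \<open>1\<close> there.\<close>
    case False
    then have z: "norm y powr p = 0" for y :: 'b by (metis norm_zero powr_0)
    show ?thesis unfolding z using n by (simp add: image_constant_conv)
  next
    case True
    then obtain y :: 'b where y: "y \<noteq> 0" by blast
    let ?c = "martingale_type_const TYPE('b) p"
    have c1: "1 \<le> ?c" by (rule martingale_type_const_ge_1[OF sp y])
    have Dint: "integrable M (?D i)" if "1 \<le> i" for i
      unfolding cond_diff_def by (intro Bochner_Integration.integrable_diff integrable_cond_exp) (use that in auto)
    have DF: "?D i \<in> borel_measurable (F i)" if "1 \<le> i" for i
      unfolding cond_diff_def
      by (intro borel_measurable_diff measurable_cond_exp that measurable_from_subalg[OF subalgebra_F measurable_cond_exp]) (use that in auto)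
    have Dp: "integrable M (\<lambda>x. norm (?D i x) powr p)" if "1 \<le> i" for i
      unfolding cond_diff_def
      by (intro nrm.integrable_powr_diff p1 integrable_cond_exp_powr borel_measurable_integrable integrable_cond_exp) (use that in auto)
    have D0: "is_cond_exp M (F (Suc i)) (?D i) (\<lambda>_. 0)" if i: "1 \<le> i" for i
    proof -
      have "is_cond_exp M (F (Suc i)) (cond_exp M (F i) (?S i)) (cond_exp M (F (Suc i)) (?S i))"
        by (rule is_cond_exp_coarser[OF is_cond_exp_partial_sum is_cond_exp_partial_sum sets_F_antimono]) (use i in auto)
      moreover have "is_cond_exp M (F (Suc i)) (cond_exp M (F (Suc i)) (?S i)) (cond_exp M (F (Suc i)) (?S i))"
        by (rule is_cond_exp_self[OF integrable_cond_exp measurable_cond_exp]) auto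
      ultimately have "is_cond_exp M (F (Suc i))
          (\<lambda>x. cond_exp M (F i) (?S i) x - cond_exp M (F (Suc i)) (?S i) x)
          (\<lambda>x. cond_exp M (F (Suc i)) (?S i) x - cond_exp M (F (Suc i)) (?S i) x)"
        by (rule is_cond_exp_diff[OF F[of "Suc i"], rotated]) simp
      then show ?thesis by (simp add: cond_diff_def[abs_def])
    qed
    have decomp: "AE x in M. ?S k x = ?E k x + (\<Sum>i\<in>{1..<k}. ?D i x)" if "1 \<le> k" for k
      by (rule sum_cond_diff_decomposition[OF that])
    have U0: "0 \<le> ?MU"
      using n by (intro Bochner_Integration.integral_nonneg Max_ge_iff[THEN iffD2]) (auto intro!: bexI[of _ 1])
    have s0: "0 \<le> ?s" by (intro sum_nonneg) simp
    show ?thesis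
    \<comment> \<open>Doob's inequality is not available at \<open>p = 1\<close>, but there the triangle inequality suffices.\<close>
    proof (cases "p = 1")
      case True
      have norm1: "norm z powr p = norm z" for z :: 'b using True by simp
      have MUi: "integrable M (\<lambda>x. MAX k\<in>{1..n}. norm (?E k x) powr p)"
        by (rule integrable_MAX) (use n integrable_cond_exp_powr in auto)
      have "AE x in M. \<forall>k\<in>{1..n}. ?S k x = ?E k x + (\<Sum>i\<in>{1..<k}. ?D i x)"
        by (rule AE_finite_allI) (use decomp in auto)
      then have ae: "AE x in M. (MAX k\<in>{1..n}. norm (?S k x) powr p) \<le>
          (MAX k\<in>{1..n}. norm (?E k x) powr p) + (\<Sum>i\<in>{1..<n}. norm (?D i x) powr p)"
      proof eventually_elim
        case (elim x)
        have "norm (?S k x) \<le> (MAX k\<in>{1..n}. norm (?E k x)) + (\<Sum>i\<in>{1..<n}. norm (?D i x))"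
          if k: "k \<in> {1..n}" for k
        proof -
          have "norm (?S k x) \<le> norm (?E k x) + norm (\<Sum>i\<in>{1..<k}. ?D i x)"
            using elim k norm_triangle_ineq by metis
          also have "norm (\<Sum>i\<in>{1..<k}. ?D i x) \<le> (\<Sum>i\<in>{1..<k}. norm (?D i x))" by (rule norm_sum)
          also have "\<dots> \<le> (\<Sum>i\<in>{1..<n}. norm (?D i x))" using k by (intro sum_mono2) auto
          also have "norm (?E k x) \<le> (MAX k\<in>{1..n}. norm (?E k x))" using k by (intro Max_ge) auto
          finally show ?thesis by simp
        qed
        then show ?case using n unfolding norm1 by (intro Max.boundedI) auto
      qed
      have "(\<integral>x. (MAX k\<in>{1..n}. norm (?S k x) powr p) \<partial>M) \<le>
          (\<integral>x. (MAX k\<in>{1..n}. norm (?E k x) powr p) + (\<Sum>i\<in>{1..<n}. norm (?D i x) powr p) \<partial>M)"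
        by (rule integral_mono_AE[OF _ _ ae])
           (use n integrable_partial_sum_powr MUi Dp in \<open>auto intro!: integrable_MAX Bochner_Integration.integrable_add Bochner_Integration.integrable_sum\<close>)
      also have "\<dots> = ?MU + (\<Sum>i\<in>{1..<n}. \<integral>x. norm (?D i x) powr p \<partial>M)"
        using MUi Dp by (subst Bochner_Integration.integral_add) (auto intro!: Bochner_Integration.integral_sum)
      also have "\<dots> = ?MU + ?s" by (simp only: idx)
      also have "\<dots> \<le> ?c * (?MU + ?s)"
        using mult_right_mono[OF c1, of "?MU + ?s"] U0 s0 by simp
      \<comment> \<open>At \<open>p = 1\<close> the division by zero gives \<open>0\<close> and both
        powers become trivial, so \<open>smooth_max_const\<close> is just \<open>?c\<close>.\<close>
      finally show ?thesis using True by (simp add: smooth_max_const_def)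
    next
      case False
      then have p: "1 < p" using p1 by simp
      let ?T = "\<lambda>x. \<Sum>i\<in>{1..<n}. ?D i x"
      let ?Z = "\<lambda>k x. \<Sum>i\<in>{k..<n}. ?D i x"
      let ?q = "(p / (p - 1)) powr p"
      have split: "?T x = (\<Sum>i\<in>{1..<k}. ?D i x) + ?Z k x" if "1 \<le> k" "k \<le> n" for k x
        using that by (simp add: sum.atLeastLessThan_concat)
      \<comment> \<open>For \<open>i < k\<close> the field \<open>F k\<close> is contained in
        \<open>F (Suc i)\<close>, so \<open>?D i\<close> has conditional expectation
        \<open>0\<close>; for \<open>i \<ge> k\<close> it is measurable for \<open>F k\<close>. The
        tail is thus an explicit version.\<close>
      have Z: "is_cond_exp M (F k) ?T (?Z k)" if k: "1 \<le> k" "k \<le> n" for k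
      proof -
        have "is_cond_exp M (F k) (\<lambda>x. \<Sum>i\<in>{1..<k}. ?D i x) (\<lambda>x. \<Sum>i\<in>{1..<k}. 0)"
          by (rule is_cond_exp_sum[OF F[OF k(1)]], rule is_cond_exp_zero_coarser[OF D0 sets_F_antimono]) auto
        moreover have "is_cond_exp M (F k) (?Z k) (?Z k)"
          by (rule is_cond_exp_sum[OF F[OF k(1)]], rule is_cond_exp_self[OF Dint measurable_from_subalg[OF subalgebra_F DF]])
             (use k in auto)
        ultimately have "is_cond_exp M (F k) (\<lambda>x. (\<Sum>i\<in>{1..<k}. ?D i x) + ?Z k x) (\<lambda>x. (\<Sum>i\<in>{1..<k}. 0) + ?Z k x)"
          by (rule is_cond_exp_add[OF F[OF k(1)]])
        then show ?thesis unfolding split[OF k] by simp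
      qed
      have le: "AE x in M. norm (?S k x) \<le> norm (?E k x) + norm (?T x) + norm (?Z k x)"
        if k: "1 \<le> k" "k \<le> n" for k
        using decomp[OF k(1)]
      proof eventually_elim
        case (elim x)
        then have "?S k x = ?E k x + ?T x - ?Z k x" using split[OF k, of x] by simp
        then show ?case
          using norm_triangle_ineq4[of "?E k x + ?T x" "?Z k x"] norm_triangle_ineq[of "?E k x" "?T x"]
          by simp
      qed
      have Tp: "integrable M (\<lambda>x. norm (?T x) powr p)"
      proof -
        have "integrable M (\<lambda>x. norm (\<Sum>i\<in>{1..<m}. ?D i x) powr p)" for m
        proof (induction m)
          case (Suc m)
          show ?case
          proof (cases "m = 0")
            case False
            have "integrable M (\<lambda>x. \<Sum>i\<in>{1..<m}. ?D i x)"
              using Dint by (intro Bochner_Integration.integrable_sum) auto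
            then show ?thesis
              using nrm.integrable_powr_add[OF p1 _ _ Suc Dp[of m]] Dint[of m] False by simp
          qed simp
        qed simp
        then show ?thesis .
      qed
      have "(\<integral>x. (MAX k\<in>{1..n}. norm (?S k x) powr p) \<partial>M) \<le>
          3 powr (p - 1) * (?MU + (1 + ?q) * (\<integral>x. norm (?T x) powr p \<partial>M))"
        by (rule maximal_powr_le[where F = F and Z = ?Z and Y = ?T and S = ?S and U = ?E, OF p F dec Z Tp integrable_cond_exp_powr n le])
      also have "\<dots> \<le> 3 powr (p - 1) * (?MU + (1 + ?q) * (?c * ?s))"
        unfolding idx
        by (intro mult_left_mono add_left_mono smooth_space_martingale_sum[where F = F and D = ?D, OF sp F dec DF D0 Dp n])
           (auto intro: add_nonneg_nonneg)
      \<comment> \<open>Since \<open>?c \<ge> 1\<close>, the factor \<open>(1 + ?q) * ?c\<close>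
        dominates the coefficient \<open>1\<close> of \<open>?MU\<close> as well.\<close>
      also have "\<dots> \<le> 3 powr (p - 1) * ((1 + ?q) * ?c * (?MU + ?s))"
      proof (rule mult_left_mono)
        have "1 * 1 \<le> (1 + ?q) * ?c" using c1 by (intro mult_mono) auto
        then have "1 * ?MU \<le> (1 + ?q) * ?c * ?MU" using U0 by (intro mult_right_mono) auto
        then show "?MU + (1 + ?q) * (?c * ?s) \<le> (1 + ?q) * ?c * (?MU + ?s)" by (simp add: algebra_simps)
      qed simp
      \<comment> \<open>Three summands cost only \<open>3 powr (p - 1)\<close>; the larger base
        matches the definition of the constant.\<close>
      also have "\<dots> \<le> 4 powr (p - 1) * ((1 + ?q) * ?c * (?MU + ?s))"
        using p c1 U0 s0 by (intro mult_right_mono powr_mono2 mult_nonneg_nonneg add_nonneg_nonneg) auto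
      finally show ?thesis by (simp add: smooth_max_const_def mult.assoc)
    qed
  qed
qed

end

theorem proposition1:
  fixes M :: "'a measure"
    and F :: "nat \<Rightarrow> 'a measure"
    and X :: "nat \<Rightarrow> 'a \<Rightarrow> 'b::{banach, second_countable_topology}"
  assumes "prob_space M"
    and "\<And>k. k \<ge> 1 \<Longrightarrow> subalgebra M (F k)"
    and "\<And>k. k \<ge> 1 \<Longrightarrow> sets (F (Suc k)) \<subseteq> sets (F k)"
    and "\<And>j. j \<ge> 1 \<Longrightarrow> X j \<in> borel_measurable (F j)"
  shows
    "(\<forall>p>1. (\<forall>j\<ge>1. integrable M (\<lambda>\<omega>. norm (X j \<omega>) powr p)) \<longrightarrow>
        (\<forall>n\<ge>1.
           (LINT \<omega>|M. (MAX k\<in>{1..n}. norm (partial_sum X k \<omega>) powr p))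
           \<le> max_const p *
              ((LINT \<omega>|M. (MAX k\<in>{1..n}. norm (cond_exp M (F k) (partial_sum X k) \<omega>) powr p))
               + (LINT \<omega>|M. norm (partial_sum X n \<omega>) powr p))))
     \<and>
     (\<forall>p. 1 \<le> p \<and> p \<le> 2 \<and> smooth_space TYPE('b) p \<longrightarrow>
        (\<forall>j\<ge>1. integrable M (\<lambda>\<omega>. norm (X j \<omega>) powr p)) \<longrightarrow>
        (\<forall>n\<ge>1.
           (LINT \<omega>|M. (MAX k\<in>{1..n}. norm (partial_sum X k \<omega>) powr p))
           \<le> smooth_max_const TYPE('b) p *
              ((LINT \<omega>|M. (MAX k\<in>{1..n}. norm (cond_exp M (F k) (partial_sum X k) \<omega>) powr p))
               + (\<Sum>i=1..n-1. LINT \<omega>|M. norm (cond_diff M F i (partial_sum X i) \<omega>) powr p))))"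
proof -
  have loc: "adapted_partial_sums M F X p"
    if "1 \<le> p" "\<forall>j\<ge>1. integrable M (\<lambda>\<omega>. norm (X j \<omega>) powr p)" for p
    using assms that by (simp add: adapted_partial_sums_def adapted_partial_sums_axioms_def)
  show ?thesis
    using adapted_partial_sums.maximal_partial_sum_le[OF loc]
      adapted_partial_sums.smooth_maximal_partial_sum_le[OF loc]
    by simp
qed

end
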